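(* For any integer $c\ge0$, the operad ${\mathbf{Hi}_{\underline{c}}}^!$ is isomorphic to the quotient of the free operad generated by the set $\{\mathsf{K}^\star_0,\dots,\mathsf{K}^\star_c\}$ of symbols of arity $2$ by the operad ideal generated by $$\mathsf{K}^\star_b\circ_1\mathsf{K}^\star_a-\mathsf{K}^\star_a\circ_2\mathsf{K}^\star_b,\qquad b\in\{0,\dots,c\},\ a\in\{0,\dots,b\}.$$
   Context: $\mathbb{N}=\{0,1,2,\dots\}$ and $\mathbb{K}$ is a field of characteristic zero. All operads are nonsymmetric operads in $\mathbb{K}$-vector spaces. Fix $c\ge0$. For a word $w$ on $\mathbb{N}$, $\ell(w)$ is its length, $w(i)$ its $i$-th letter, $\epsilon$ the empty word, $|w|:=\ell(w)+1$. $\mathsf{Cl}_{\underline{c}}$ is the set of all words on $\{0,\dots,c\}$, and $\mathsf{Hi}_{\underline{c}}$ is its subset of weakly increasing words. $\mathbf{Cl}_{\underline{c}}$ is the operad with basis $\{\mathsf{E}_w:w\in\mathsf{Cl}_{\underline{c}}\}$, $\mathsf{E}_w$ of arity $|w|$, with $\mathsf{E}_u\circ_i\mathsf{E}_v:=\mathsf{E}_{u(1)\cdots u(i-1)\,v\,u(i)\cdots u(\ell(u))}$ for $1\le i\le|u|$, and unit $\mathsf{E}_\epsilon$. For words of the same length, $u\preccurlyeq v$ iff $u(j)\le v(j)$ for all $j$. The $\mathsf{F}$-basis of $\mathbf{Cl}_{\underline{c}}$ is determined by $\mathsf{E}_w=\sum_{w'\in\mathsf{Cl}_{\underline{c}},\,w\preccurlyeq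 w'}\mathsf{F}_{w'}$ (Möbius inversion). The span of $\{\mathsf{F}_w:w\in\mathsf{Cl}_{\underline{c}}\setminus\mathsf{Hi}_{\underline{c}}\}$ is an operad ideal, and $\mathbf{Hi}_{\underline{c}}$ is the quotient operad; for $w\in\mathsf{Hi}_{\underline{c}}$, $\mathsf{E}_w\in\mathbf{Hi}_{\underline{c}}$ denotes the image of $\mathsf{E}_w$. The operad $\mathbf{Hi}_{\underline{c}}$ is binary and quadratic: it is the quotient of the free operad on the arity-$2$ generators $\mathsf{E}_0,\dots,\mathsf{E}_c$ by the ideal generated by the space $R$ (in arity $3$ of the free operad) spanned by $\mathsf{E}_a\circ_1\mathsf{E}_b-\mathsf{E}_b\circ_2\mathsf{E}_{a'}$ for $0\le a,a'\le b\le c$ and $\mathsf{E}_b\circ_1\mathsf{E}_a-\mathsf{E}_a\circ_2\mathsf{E}_b$ for $0\le a<b\le c$. Its Koszul dual ${\mathbf{Hi}_{\underline{c}}}^!$ is the quotient of the free operad on the dual arity-$2$ generators $\mathsf{E}^\star_0,\dots,\mathsf{E}^\star_c$ by the ideal generated by the annihilator $R^\perp$ of $R$ for the pairing in arity $3$ given by $\langle\mathsf{E}^\star_x\circ_i\mathsf{E}^\star_y,\mathsf{E}_{x'}\circ_{i'}\mathsf{E}_{y'}\rangle:=1$ if $(x,y,i)=(x',y',i')$ and $i=1$, $-1$ if $(x,y,i)=(x',y',i')$ and $i=2$, and $0$ otherwise. In ${\mathbf{Hi}_{\underline{c}}}^!$, the symbol $\mathsf{K}^\star_b$ stands for the element $\mathsf{K}^\star_b:=\sum_{a\in\{0,\dots,b\}}\mathsf{E}^\star_a$,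 $b\in\{0,\dots,c\}$. *)

theory Defs
  imports
    "HOL.Hull"
    "HOL-Library.Tree"
    "HOL-Library.Poly_Mapping"
    "HOL-Algebra.AbelCoset"
    "HOL-Algebra.Module"
begin

text \<open>The type-class field \<open>'k\<close> as a ring record, so that HOL-Algebra modules over it are
  vector spaces.\<close>

definition base_field :: "'k::field ring" where
  "base_field = \<lparr>carrier = UNIV, mult = (*), one = 1, zero = 0, add = (+)\<rparr>"

text \<open>\<open>arity_space P n\<close> is the space \<open>P(n)\<close>; its ring multiplication and ring unit, which the
  record type of modules carries along, are irrelevant. The value \<open>pcomp P m i n x y\<close> is
  \<open>x \<circ>\<^sub>i y\<close> for \<open>x \<in> P(m)\<close> and \<open>y \<in> P(n)\<close>, with \<open>1 \<le> i \<le> m\<close>.\<close>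

record ('k, 'a) operad =
  arity_space :: "nat \<Rightarrow> ('k, 'a) module"
  pcomp :: "nat \<Rightarrow> nat \<Rightarrow> nat \<Rightarrow> 'a \<Rightarrow> 'a \<Rightarrow> 'a"
  operad_unit :: 'a

abbreviation elems :: "('k, 'a) operad \<Rightarrow> nat \<Rightarrow> 'a set" where
  "elems P n \<equiv> carrier (arity_space P n)"

locale ns_operad =
  fixes P :: "('k::field, 'a) operad"
  assumes vector_space: "Module.module base_field (arity_space P n)"
    and unit_closed: "operad_unit P \<in> elems P 1"
    and pcomp_closed:
      "\<lbrakk>x \<in> elems P m; y \<in> elems P n; 1 \<le> i; i \<le> m\<rbrakk> \<Longrightarrow> pcomp P m i n x y \<in> elems P (m + n - 1)"
    and pcomp_add_left:
      "\<lbrakk>x \<in> elems P m; x' \<in> elems P m; y \<in> elems P n; 1 \<le> i; i \<le> m\<rbrakk> \<Longrightarrow>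
        pcomp P m i n (x \<oplus>\<^bsub>arity_space P m\<^esub> x') y =
        pcomp P m i n x y \<oplus>\<^bsub>arity_space P (m + n - 1)\<^esub> pcomp P m i n x' y"
    and pcomp_add_right:
      "\<lbrakk>x \<in> elems P m; y \<in> elems P n; y' \<in> elems P n; 1 \<le> i; i \<le> m\<rbrakk> \<Longrightarrow>
        pcomp P m i n x (y \<oplus>\<^bsub>arity_space P n\<^esub> y') =
        pcomp P m i n x y \<oplus>\<^bsub>arity_space P (m + n - 1)\<^esub> pcomp P m i n x y'"
    and pcomp_smult_left:
      "\<lbrakk>x \<in> elems P m; y \<in> elems P n; 1 \<le> i; i \<le> m\<rbrakk> \<Longrightarrow>
        pcomp P m i n (k \<odot>\<^bsub>arity_space P m\<^esub> x) y = k \<odot>\<^bsub>arity_space P (m + n - 1)\<^esub> pcomp P m i n x y"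
    and pcomp_smult_right:
      "\<lbrakk>x \<in> elems P m; y \<in> elems P n; 1 \<le> i; i \<le> m\<rbrakk> \<Longrightarrow>
        pcomp P m i n x (k \<odot>\<^bsub>arity_space P n\<^esub> y) = k \<odot>\<^bsub>arity_space P (m + n - 1)\<^esub> pcomp P m i n x y"
    and pcomp_series:
      "\<lbrakk>x \<in> elems P m; y \<in> elems P n; z \<in> elems P l; 1 \<le> i; i \<le> m; 1 \<le> j; j \<le> n\<rbrakk> \<Longrightarrow>
        pcomp P (m + n - 1) (i + j - 1) l (pcomp P m i n x y) z =
        pcomp P m i (n + l - 1) x (pcomp P n j l y z)"
    and pcomp_parallel:
      "\<lbrakk>x \<in> elems P m; y \<in> elems P n; z \<in> elems P l; 1 \<le> i; i < j; j \<le> m\<rbrakk> \<Longrightarrow>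
        pcomp P (m + n - 1) (j + n - 1) l (pcomp P m i n x y) z =
        pcomp P (m + l - 1) i n (pcomp P m j l x z) y"
    and pcomp_unit_left: "x \<in> elems P n \<Longrightarrow> pcomp P 1 1 n (operad_unit P) x = x"
    and pcomp_unit_right:
      "\<lbrakk>x \<in> elems P m; 1 \<le> i; i \<le> m\<rbrakk> \<Longrightarrow> pcomp P m i 1 x (operad_unit P) = x"

definition operad_hom ::
    "('k::field, 'a) operad \<Rightarrow> ('k, 'b) operad \<Rightarrow> (nat \<Rightarrow> 'a \<Rightarrow> 'b) set" where
  "operad_hom P Q = {\<phi>.
     (\<forall>n. \<phi> n \<in> elems P n \<rightarrow> elems Q n) \<and>
     (\<forall>n. \<forall>x\<in>elems P n. \<forall>y\<in>elems P n.
        \<phi> n (x \<oplus>\<^bsub>arity_space P n\<^esub> y) = \<phi> n x \<oplus>\<^bsub>arity_space Q n\<^esub> \<phi> n y) \<and>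
     (\<forall>n k. \<forall>x\<in>elems P n. \<phi> n (k \<odot>\<^bsub>arity_space P n\<^esub> x) = k \<odot>\<^bsub>arity_space Q n\<^esub> \<phi> n x) \<and>
     \<phi> 1 (operad_unit P) = operad_unit Q \<and>
     (\<forall>m n i. \<forall>x\<in>elems P m. \<forall>y\<in>elems P n. 1 \<le> i \<and> i \<le> m \<longrightarrow>
        \<phi> (m + n - 1) (pcomp P m i n x y) = pcomp Q m i n (\<phi> m x) (\<phi> n y))}"

definition operad_iso ::
    "('k::field, 'a) operad \<Rightarrow> ('k, 'b) operad \<Rightarrow> (nat \<Rightarrow> 'a \<Rightarrow> 'b) set" where
  "operad_iso P Q = {\<phi> \<in> operad_hom P Q. \<forall>n. bij_betw (\<phi> n) (elems P n) (elems Q n)}"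

definition operad_ideal :: "('k::field, 'a) operad \<Rightarrow> (nat \<Rightarrow> 'a set) \<Rightarrow> bool" where
  "operad_ideal P I \<longleftrightarrow>
     (\<forall>n. submodule (I n) base_field (arity_space P n)) \<and>
     (\<forall>m n i x y. 1 \<le> i \<and> i \<le> m \<and> x \<in> elems P m \<and> y \<in> elems P n \<and> (x \<in> I m \<or> y \<in> I n) \<longrightarrow>
        pcomp P m i n x y \<in> I (m + n - 1))"

text \<open>The least ideal containing the graded set \<open>G\<close>; the infimum is taken aritywise.\<close>

definition generated_ideal ::
    "('k::field, 'a) operad \<Rightarrow> (nat \<Rightarrow> 'a set) \<Rightarrow> nat \<Rightarrow> 'a set" where
  "generated_ideal P G = Inf {I. operad_ideal P I \<and> G \<le> I}"

definition quotient_module ::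
    "('k::field, 'a) module \<Rightarrow> 'a set \<Rightarrow> ('k, 'a set) module" where
  "quotient_module M H =
     \<lparr>carrier = a_rcosets\<^bsub>M\<^esub> H, mult = undefined, one = undefined, zero = H, add = set_add M,
      smult = (\<lambda>k C. \<Union>x\<in>C. H +>\<^bsub>M\<^esub> (k \<odot>\<^bsub>M\<^esub> x))\<rparr>"

definition quotient_operad ::
    "('k::field, 'a) operad \<Rightarrow> (nat \<Rightarrow> 'a set) \<Rightarrow> ('k, 'a set) operad" where
  "quotient_operad P I =
     \<lparr>arity_space = (\<lambda>n. quotient_module (arity_space P n) (I n)),
      pcomp = (\<lambda>m i n C D. \<Union>x\<in>C. \<Union>y\<in>D.
        I (m + n - 1) +>\<^bsub>arity_space P (m + n - 1)\<^esub> pcomp P m i n x y),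
      operad_unit = I 1 +>\<^bsub>arity_space P 1\<^esub> operad_unit P\<rparr>"

text \<open>A basis of the arity-\<open>n\<close> component of the free operad on a set \<open>X\<close> of generators of arity 2
  is given by the planar binary trees with inner nodes labelled by \<open>X\<close> and with \<open>n\<close> leaves
  (\<^const>\<open>size1\<close> counts leaves). Leaves are numbered from 1, from left to right, and \<open>graft t i s\<close>
  replaces the \<open>i\<close>-th leaf of \<open>t\<close> by \<open>s\<close>.\<close>

fun graft :: "'x tree \<Rightarrow> nat \<Rightarrow> 'x tree \<Rightarrow> 'x tree" where
  "graft Leaf i s = s"
| "graft (Node l a r) i s =
     (if i \<le> size1 l then Node (graft l i s) a r else Node l a (graft r (i - size1 l) s))"

definition tree_comp ::
    "('x tree \<Rightarrow>\<^sub>0 'k::field) \<Rightarrow> nat \<Rightarrow> ('x tree \<Rightarrow>\<^sub>0 'k) \<Rightarrow> ('x tree \<Rightarrow>\<^sub>0 'k)"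
    ("(_ \<circ>\<^bsub>_\<^esub> _)" [71, 0, 71] 70) where
  "f \<circ>\<^bsub>i\<^esub> g = (\<Sum>t\<in>Poly_Mapping.keys f. \<Sum>s\<in>Poly_Mapping.keys g.
     Poly_Mapping.single (graft t i s) (Poly_Mapping.lookup f t * Poly_Mapping.lookup g s))"

definition tree_space :: "'x set \<Rightarrow> nat \<Rightarrow> ('k::field, 'x tree \<Rightarrow>\<^sub>0 'k) module" where
  "tree_space X n =
     \<lparr>carrier = {f. \<forall>t\<in>Poly_Mapping.keys f. set_tree t \<subseteq> X \<and> size1 t = n},
      mult = undefined, one = undefined, zero = 0, add = (+),
      smult = (\<lambda>k. Poly_Mapping.map ((*) k))\<rparr>"

definition free_operad :: "'x set \<Rightarrow> ('k::field, 'x tree \<Rightarrow>\<^sub>0 'k) operad" where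
  "free_operad X =
     \<lparr>arity_space = tree_space X,
      pcomp = (\<lambda>m i n f g. f \<circ>\<^bsub>i\<^esub> g),
      operad_unit = Poly_Mapping.single Leaf 1\<rparr>"

abbreviation corolla :: "'x \<Rightarrow> 'x tree" where
  "corolla x \<equiv> Node Leaf x Leaf"

definition gen :: "'x \<Rightarrow> ('x tree \<Rightarrow>\<^sub>0 'k::field)" where
  "gen x = Poly_Mapping.single (corolla x) 1"

definition quadratic_ideal ::
    "'x set \<Rightarrow> ('x tree \<Rightarrow>\<^sub>0 'k::field) set \<Rightarrow> nat \<Rightarrow> ('x tree \<Rightarrow>\<^sub>0 'k) set" where
  "quadratic_ideal X R = generated_ideal (free_operad X) (\<lambda>n. if n = 3 then R else {})"

definition quadratic_operad ::
    "'x set \<Rightarrow> ('x tree \<Rightarrow>\<^sub>0 'k::field) set \<Rightarrow> ('k, ('x tree \<Rightarrow>\<^sub>0 'k) set) operad" where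
  "quadratic_operad X R = quotient_operad (free_operad X) (quadratic_ideal X R)"

definition quadratic_gen ::
    "'x set \<Rightarrow> ('x tree \<Rightarrow>\<^sub>0 'k::field) set \<Rightarrow> 'x \<Rightarrow> ('x tree \<Rightarrow>\<^sub>0 'k) set" where
  "quadratic_gen X R x = quadratic_ideal X R 2 +>\<^bsub>tree_space X 2\<^esub> gen x"

text \<open>The generator dual to \<open>x \<in> X\<close> is again denoted by the label \<open>x\<close>. The trees
  \<open>graft (corolla x) i (corolla y)\<close> with \<open>i \<in> {1, 2}\<close> form the basis of the arity-3 component
  of either free operad, and they are pairwise orthogonal for the pairing, with square \<open>1\<close> for
  \<open>i = 1\<close> and \<open>- 1\<close> for \<open>i = 2\<close>.\<close>

definition pairing ::
    "'x set \<Rightarrow> ('x tree \<Rightarrow>\<^sub>0 'k::field) \<Rightarrow> ('x tree \<Rightarrow>\<^sub>0 'k) \<Rightarrow> 'k" where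
  "pairing X f g = (\<Sum>x\<in>X. \<Sum>y\<in>X. \<Sum>i\<in>{1, 2}. (if i = 1 then 1 else - 1) *
     Poly_Mapping.lookup f (graft (corolla x) i (corolla y)) *
     Poly_Mapping.lookup g (graft (corolla x) i (corolla y)))"

definition annihilator ::
    "'x set \<Rightarrow> ('x tree \<Rightarrow>\<^sub>0 'k::field) set \<Rightarrow> ('x tree \<Rightarrow>\<^sub>0 'k) set" where
  "annihilator X R = {f \<in> carrier (tree_space X 3). \<forall>r\<in>R. pairing X f r = 0}"

definition koszul_dual ::
    "'x set \<Rightarrow> ('x tree \<Rightarrow>\<^sub>0 'k::field) set \<Rightarrow> ('k, ('x tree \<Rightarrow>\<^sub>0 'k) set) operad" where
  "koszul_dual X R = quadratic_operad X (annihilator X R)"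

definition Hi_relations :: "nat \<Rightarrow> (nat tree \<Rightarrow>\<^sub>0 'k::field) set" where
  "Hi_relations c = (\<lambda>H. submodule H base_field (tree_space {0..c} 3)) hull
     ({gen a \<circ>\<^bsub>1\<^esub> gen b - gen b \<circ>\<^bsub>2\<^esub> gen a' | a a' b. a \<le> b \<and> a' \<le> b \<and> b \<le> c} \<union>
      {gen b \<circ>\<^bsub>1\<^esub> gen a - gen a \<circ>\<^bsub>2\<^esub> gen b | a b. a < b \<and> b \<le> c})"

definition Hi_dual :: "nat \<Rightarrow> ('k::field, (nat tree \<Rightarrow>\<^sub>0 'k) set) operad" where
  "Hi_dual c = koszul_dual {0..c} (Hi_relations c)"

definition Estar :: "nat \<Rightarrow> nat \<Rightarrow> (nat tree \<Rightarrow>\<^sub>0 'k::field) set" where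
  "Estar c a = quadratic_gen {0..c} (annihilator {0..c} (Hi_relations c)) a"

definition Kstar :: "nat \<Rightarrow> nat \<Rightarrow> (nat tree \<Rightarrow>\<^sub>0 'k::field) set" where
  "Kstar c b = (\<Oplus>\<^bsub>arity_space (Hi_dual c) 2\<^esub> a\<in>{0..b}. Estar c a)"

text \<open>In the relations of the new presentation, the label \<open>b\<close> stands for the formal symbol
  \<open>K\<^sup>\<star>\<^sub>b\<close>.\<close>

definition Kstar_relations :: "nat \<Rightarrow> (nat tree \<Rightarrow>\<^sub>0 'k::field) set" where
  "Kstar_relations c = {gen b \<circ>\<^bsub>1\<^esub> gen a - gen a \<circ>\<^bsub>2\<^esub> gen b | a b. b \<le> c \<and> a \<le> b}"

definition Kstar_operad :: "nat \<Rightarrow> ('k::field, (nat tree \<Rightarrow>\<^sub>0 'k) set) operad" where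
  "Kstar_operad c = quadratic_operad {0..c} (Kstar_relations c)"

definition Kstar_symbol :: "nat \<Rightarrow> nat \<Rightarrow> (nat tree \<Rightarrow>\<^sub>0 'k::field) set" where
  "Kstar_symbol c b = quadratic_gen {0..c} (Kstar_relations c) b"

text \<open>The free operads and their quotients satisfy the axioms of \<^locale>\<open>ns_operad\<close>, and
  generated ideals are ideals.\<close>

declare One_nat_def [simp del]

lemma base_field_simps [simp]:
  "carrier base_field = UNIV" "mult base_field = (*)" "one base_field = 1"
  "zero base_field = 0" "add base_field = (+)"
  by (simp_all add: base_field_def)

lemma cring_base_field: "cring (base_field :: 'k::field ring)"
proof (rule cringI)
  show "abelian_group (base_field :: 'k ring)"
    by (rule abelian_groupI) (auto simp: algebra_simps intro: exI[of _ "- x" for x])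
  show "Group.comm_monoid (base_field :: 'k ring)"
    by (rule comm_monoidI) (auto simp: algebra_simps)
qed (auto simp: algebra_simps)

lemma tree_space_simps [simp]:
  "zero (tree_space X n) = 0" "add (tree_space X n) = (+)"
  "smult (tree_space X n) = (\<lambda>k. Poly_Mapping.map ((*) k))"
  by (simp_all add: tree_space_def)

lemma carrier_tree_space:
  "f \<in> carrier (tree_space X n) \<longleftrightarrow> (\<forall>t\<in>Poly_Mapping.keys f. set_tree t \<subseteq> X \<and> size1 t = n)"
  by (simp add: tree_space_def)

lemma lookup_scale [simp]:
  "Poly_Mapping.lookup (Poly_Mapping.map ((*) (k::'k::field)) f) t = k * Poly_Mapping.lookup f t"
  by (simp add: Poly_Mapping.map.rep_eq when_def)

lemma carrier_tree_space_lookup: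
  "f \<in> carrier (tree_space X n) \<longleftrightarrow>
    (\<forall>t. Poly_Mapping.lookup f t \<noteq> 0 \<longrightarrow> set_tree t \<subseteq> X \<and> size1 t = n)"
  by (auto simp: carrier_tree_space in_keys_iff)

lemma module_tree_space: "Module.module base_field (tree_space X n :: ('k::field, _) module)"
proof (rule moduleI)
  show "abelian_group (tree_space X n :: ('k, _) module)"
  proof (rule abelian_groupI)
    fix x :: "'a tree \<Rightarrow>\<^sub>0 'k" assume "x \<in> carrier (tree_space X n)"
    then show "\<exists>y\<in>carrier (tree_space X n). y \<oplus>\<^bsub>tree_space X n\<^esub> x = \<zero>\<^bsub>tree_space X n\<^esub>"
      by (intro bexI[of _ "-x"]) (auto simp: carrier_tree_space_lookup)
  next
    fix x y :: "'a tree \<Rightarrow>\<^sub>0 'k"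
    assume a: "x \<in> carrier (tree_space X n)" "y \<in> carrier (tree_space X n)"
    show "x \<oplus>\<^bsub>tree_space X n\<^esub> y \<in> carrier (tree_space X n)"
      using a unfolding carrier_tree_space_lookup by (metis add.right_neutral lookup_add tree_space_simps(2))
  qed (auto simp: carrier_tree_space_lookup algebra_simps)
qed (auto simp: cring_base_field carrier_tree_space_lookup lookup_add algebra_simps intro!: poly_mapping_eqI)

lemma tree_space_add_closed:
  fixes x y :: "'x tree \<Rightarrow>\<^sub>0 'k::field"
  assumes "x \<in> carrier (tree_space X n)" "y \<in> carrier (tree_space X n)"
  shows "x + y \<in> carrier (tree_space X n)"
proof -
  interpret Module.module base_field "tree_space X n :: ('k, _) module" by (rule module_tree_space)
  show ?thesis using M.a_closed[OF assms] by simp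
qed

lemma tree_space_diff_closed:
  fixes x y :: "'x tree \<Rightarrow>\<^sub>0 'k::field"
  assumes "x \<in> carrier (tree_space X n)" "y \<in> carrier (tree_space X n)"
  shows "x - y \<in> carrier (tree_space X n)"
  using assms keys_diff[of x y] unfolding carrier_tree_space by blast

lemma size1_graft: "1 \<le> i \<Longrightarrow> i \<le> size1 t \<Longrightarrow> size1 (graft t i s) = size1 t + size1 s - 1"
proof (induction t i s rule: graft.induct)
  case (2 l a r i s)
  show ?case
  proof (cases "i \<le> size1 l")
    case True
    then have "size1 (graft l i s) = size1 l + size1 s - 1" using 2 by auto
    moreover have "size1 s \<ge> 1" "size1 l \<ge> 1" by (auto simp: size1_size)
    ultimately show ?thesis using True by simp
  next
    case False
    then have "size1 (graft r (i - size1 l) s) = size1 r + size1 s - 1" using 2 by auto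
    moreover have "size1 s \<ge> 1" "size1 r \<ge> 1" by (auto simp: size1_size)
    ultimately show ?thesis using False by simp
  qed
qed (simp add: size1_size)

lemma set_graft: "set_tree (graft t i s) \<subseteq> set_tree t \<union> set_tree s"
  by (induction t i s rule: graft.induct) auto

lemma size1_pos: "1 \<le> size1 t"
  by (simp add: size1_size)

lemma graft_series:
  "1 \<le> i \<Longrightarrow> i \<le> size1 t \<Longrightarrow> 1 \<le> j \<Longrightarrow> j \<le> size1 s \<Longrightarrow>
    graft (graft t i s) (i + j - 1) u = graft t i (graft s j u)"
proof (induction t i s rule: graft.induct)
  case (2 l a r i s)
  show ?case
  proof (cases "i \<le> size1 l")
    case True
    then show ?thesis using 2 by (auto simp: size1_graft)
  next
    case False
    have "graft (graft r (i - size1 l) s) (i - size1 l + j - 1) u = graft r (i - size1 l) (graft s j u)"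
      using 2 False by auto
    moreover have "i + j - 1 - size1 l = i - size1 l + j - 1" using False by simp
    ultimately show ?thesis using False 2 by auto
  qed
qed simp

lemma graft_parallel:
  "1 \<le> i \<Longrightarrow> i < j \<Longrightarrow> j \<le> size1 t \<Longrightarrow>
    graft (graft t i s) (j + size1 s - 1) u = graft (graft t j u) i s"
proof (induction t arbitrary: i j)
  case (Node l a r)
  have p: "size1 s \<ge> 1" "size1 u \<ge> 1" "size1 l \<ge> 1" by (rule size1_pos)+
  consider "j \<le> size1 l" | "i \<le> size1 l" "size1 l < j" | "size1 l < i" using Node.prems by linarith
  then show ?case
  proof cases
    case 1
    then show ?thesis using Node p by (auto simp: size1_graft)
  next
    case 2
    then show ?thesis using Node.prems p by (auto simp: size1_graft)
  next
    case 3
    have "graft (graft r (i - size1 l) s) (j - size1 l + size1 s - 1) u =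
        graft (graft r (j - size1 l) u) (i - size1 l) s"
      using Node.IH(2)[of "i - size1 l" "j - size1 l"] Node.prems 3 by auto
    moreover have "j + size1 s - 1 - size1 l = j - size1 l + size1 s - 1" using 3 Node.prems by simp
    ultimately show ?thesis using 3 Node.prems p by auto
  qed
qed auto

lemma graft_Leaf: "graft t i Leaf = t"
  by (induction t arbitrary: i) auto

lemma tree_comp_superset:
  assumes "finite A" "finite B" "Poly_Mapping.keys f \<subseteq> A" "Poly_Mapping.keys g \<subseteq> B"
  shows "f \<circ>\<^bsub>i\<^esub> g = (\<Sum>t\<in>A. \<Sum>s\<in>B.
     Poly_Mapping.single (graft t i s) (Poly_Mapping.lookup f t * Poly_Mapping.lookup g s))"
  unfolding tree_comp_def
proof (rule sum.mono_neutral_cong_left)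
  show "\<forall>t\<in>A - Poly_Mapping.keys f. (\<Sum>s\<in>B.
      Poly_Mapping.single (graft t i s) (Poly_Mapping.lookup f t * Poly_Mapping.lookup g s)) = 0"
    by (simp add: in_keys_iff)
  show "(\<Sum>s\<in>Poly_Mapping.keys g.
      Poly_Mapping.single (graft t i s) (Poly_Mapping.lookup f t * Poly_Mapping.lookup g s)) =
    (\<Sum>s\<in>B. Poly_Mapping.single (graft t i s) (Poly_Mapping.lookup f t * Poly_Mapping.lookup g s))" for t
    by (rule sum.mono_neutral_left) (use assms in \<open>auto simp: in_keys_iff\<close>)
qed (use assms in auto)

lemma tree_comp_add_left: "(f + f') \<circ>\<^bsub>i\<^esub> g = f \<circ>\<^bsub>i\<^esub> g + f' \<circ>\<^bsub>i\<^esub> g"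
proof -
  let ?A = "Poly_Mapping.keys f \<union> Poly_Mapping.keys f'" and ?B = "Poly_Mapping.keys g"
  have "Poly_Mapping.keys (f + f') \<subseteq> ?A" by (rule Poly_Mapping.keys_add)
  then show ?thesis
    by (simp add: tree_comp_superset[of ?A ?B] lookup_add distrib_right single_add sum.distrib)
qed

lemma tree_comp_add_right: "f \<circ>\<^bsub>i\<^esub> (g + g') = f \<circ>\<^bsub>i\<^esub> g + f \<circ>\<^bsub>i\<^esub> g'"
proof -
  let ?A = "Poly_Mapping.keys f" and ?B = "Poly_Mapping.keys g \<union> Poly_Mapping.keys g'"
  have "Poly_Mapping.keys (g + g') \<subseteq> ?B" by (rule Poly_Mapping.keys_add)
  then show ?thesis
    by (simp add: tree_comp_superset[of ?A ?B] lookup_add distrib_left single_add sum.distrib)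
qed

lemma scale_add: "Poly_Mapping.map ((*) (k::'k::field)) (f + g) =
    Poly_Mapping.map ((*) k) f + Poly_Mapping.map ((*) k) g"
  by (rule poly_mapping_eqI) (simp add: lookup_add algebra_simps)

lemma scale_0 [simp]: "Poly_Mapping.map ((*) (k::'k::field)) 0 = 0"
  by (rule poly_mapping_eqI) simp

lemma scale_sum: "Poly_Mapping.map ((*) (k::'k::field)) (sum F A) = (\<Sum>a\<in>A. Poly_Mapping.map ((*) k) (F a))"
  by (induction A rule: infinite_finite_induct) (simp_all add: scale_add)

lemma scale_single: "Poly_Mapping.map ((*) (k::'k::field)) (Poly_Mapping.single t c) = Poly_Mapping.single t (k * c)"
  by (rule poly_mapping_eqI) (simp add: lookup_single when_def)

lemma keys_scale: "Poly_Mapping.keys (Poly_Mapping.map ((*) (k::'k::field)) f) \<subseteq> Poly_Mapping.keys f"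
  by (auto simp: in_keys_iff)

lemma tree_comp_scale_left:
  "Poly_Mapping.map ((*) k) f \<circ>\<^bsub>i\<^esub> g = Poly_Mapping.map ((*) k) (f \<circ>\<^bsub>i\<^esub> g)"
  using keys_scale[of k f]
  by (simp add: tree_comp_superset[of "Poly_Mapping.keys f" "Poly_Mapping.keys g"]
      scale_sum scale_single algebra_simps)

lemma tree_comp_scale_right:
  "f \<circ>\<^bsub>i\<^esub> Poly_Mapping.map ((*) k) g = Poly_Mapping.map ((*) k) (f \<circ>\<^bsub>i\<^esub> g)"
  using keys_scale[of k g]
  by (simp add: tree_comp_superset[of "Poly_Mapping.keys f" "Poly_Mapping.keys g"]
      scale_sum scale_single algebra_simps)

lemma tree_comp_single:
  "Poly_Mapping.single t a \<circ>\<^bsub>i\<^esub> Poly_Mapping.single s b = Poly_Mapping.single (graft t i s) (a * b)"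
  by (simp add: tree_comp_superset[of "{t}" "{s}"])

lemma tree_space_induct [consumes 1, case_names zero single add]:
  assumes "f \<in> carrier (tree_space X n)"
    and "Q 0"
    and "\<And>t a. set_tree t \<subseteq> X \<Longrightarrow> size1 t = n \<Longrightarrow> Q (Poly_Mapping.single t a)"
    and "\<And>f g. f \<in> carrier (tree_space X n) \<Longrightarrow> g \<in> carrier (tree_space X n) \<Longrightarrow> Q f \<Longrightarrow> Q g \<Longrightarrow> Q (f + g)"
  shows "Q f"
proof -
  let ?F = "\<lambda>A. \<Sum>t\<in>A. Poly_Mapping.single t (Poly_Mapping.lookup f t)"
  have "?F A \<in> carrier (tree_space X n) \<and> Q (?F A)" if "finite A" "A \<subseteq> Poly_Mapping.keys f" for A
    using that
  proof (induction A)
    case (insert t A)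
    have s: "Poly_Mapping.single t (Poly_Mapping.lookup f t) \<in> carrier (tree_space X n)"
      "Q (Poly_Mapping.single t (Poly_Mapping.lookup f t))"
      using insert assms(1,3) by (auto simp: carrier_tree_space_lookup lookup_single when_def in_keys_iff)
    show ?case using insert s tree_space_add_closed[OF s(1), of "?F A"] assms(4)[OF s(1), of "?F A"] by simp
  qed (use assms in \<open>simp add: carrier_tree_space\<close>)
  moreover have "?F (Poly_Mapping.keys f) = f"
    by (rule poly_mapping_eqI) (simp add: lookup_sum lookup_single when_def in_keys_iff)
  ultimately show ?thesis by (metis finite_keys order_refl)
qed

lemma free_operad_simps [simp]:
  "arity_space (free_operad X) = tree_space X" "pcomp (free_operad X) m i n f g = f \<circ>\<^bsub>i\<^esub> g"
  "operad_unit (free_operad X) = Poly_Mapping.single Leaf 1"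
  by (simp_all add: free_operad_def)

lemma tree_comp_0 [simp]: "0 \<circ>\<^bsub>i\<^esub> g = 0" "f \<circ>\<^bsub>i\<^esub> 0 = 0"
  by (simp_all add: tree_comp_def)

lemma tree_comp_closed:
  assumes "f \<in> carrier (tree_space X m)" "g \<in> carrier (tree_space X n)" "1 \<le> i" "i \<le> m"
  shows "f \<circ>\<^bsub>i\<^esub> g \<in> carrier (tree_space X (m + n - 1))"
proof -
  note add = tree_space_add_closed
  have z: "0 \<in> carrier (tree_space X n)" for n by (simp add: carrier_tree_space)
  show ?thesis using assms(1)
  proof (induction rule: tree_space_induct)
    case (single t a)
    note s = this
    show ?case using assms(2)
    proof (induction rule: tree_space_induct)
      case (single u b)
      then show ?case using s assms set_graft[of t i u]
        by (auto simp: tree_comp_single carrier_tree_space size1_graft)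
    qed (auto simp: tree_comp_add_right add z)
  qed (auto simp: tree_comp_add_left add z)
qed

lemma tree_comp_series:
  assumes "f \<in> carrier (tree_space X m)" "g \<in> carrier (tree_space X n)" "h \<in> carrier (tree_space X l)"
    "1 \<le> i" "i \<le> m" "1 \<le> j" "j \<le> n"
  shows "(f \<circ>\<^bsub>i\<^esub> g) \<circ>\<^bsub>i + j - 1\<^esub> h = f \<circ>\<^bsub>i\<^esub> (g \<circ>\<^bsub>j\<^esub> h)"
  using assms(1)
proof (induction rule: tree_space_induct)
  case (single t a)
  note t = this
  show ?case using assms(2)
  proof (induction rule: tree_space_induct)
    case (single s b)
    note s = this
    show ?case using assms(3)
    proof (induction rule: tree_space_induct)
      case (single u c)
      then show ?case using graft_series[of i t j s u] t s assms
        by (auto simp: tree_comp_single mult_ac)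
    qed (auto simp: tree_comp_add_left tree_comp_add_right)
  qed (auto simp: tree_comp_add_left tree_comp_add_right)
qed (auto simp: tree_comp_add_left)

lemma tree_comp_parallel:
  assumes "f \<in> carrier (tree_space X m)" "g \<in> carrier (tree_space X n)" "h \<in> carrier (tree_space X l)"
    "1 \<le> i" "i < j" "j \<le> m"
  shows "(f \<circ>\<^bsub>i\<^esub> g) \<circ>\<^bsub>j + n - 1\<^esub> h = (f \<circ>\<^bsub>j\<^esub> h) \<circ>\<^bsub>i\<^esub> g"
  using assms(1)
proof (induction rule: tree_space_induct)
  case (single t a)
  note t = this
  show ?case using assms(2)
  proof (induction rule: tree_space_induct)
    case (single s b)
    note s = this
    show ?case using assms(3)
    proof (induction rule: tree_space_induct)
      case (single u c)
      then show ?case using graft_parallel[of i j t s u] t s assms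
        by (auto simp: tree_comp_single mult_ac)
    qed (auto simp: tree_comp_add_left tree_comp_add_right)
  qed (auto simp: tree_comp_add_left tree_comp_add_right)
qed (auto simp: tree_comp_add_left)

lemma unit_in_tree_space: "Poly_Mapping.single Leaf 1 \<in> carrier (tree_space X 1)"
  by (simp add: carrier_tree_space)

lemma ns_operad_free: "ns_operad (free_operad (X :: 'a set) :: ('k::field, _) operad)"
proof (rule ns_operad.intro)
  show "Module.module base_field (arity_space (free_operad X :: ('k, _) operad) n)" for n
    by (simp add: module_tree_space)
  show "pcomp (free_operad X) 1 1 n (operad_unit (free_operad X)) f = f"
    if "f \<in> elems (free_operad X) n" for f :: "'a tree \<Rightarrow>\<^sub>0 'k" and n
    using that unfolding free_operad_simps
    by (induction rule: tree_space_induct) (auto simp: tree_comp_single tree_comp_add_right)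
  show "pcomp (free_operad X) m i 1 f (operad_unit (free_operad X)) = f"
    if "f \<in> elems (free_operad X) m" for f :: "'a tree \<Rightarrow>\<^sub>0 'k" and m i
    using that unfolding free_operad_simps
    by (induction rule: tree_space_induct) (auto simp: tree_comp_single tree_comp_add_left graft_Leaf)
qed (simp_all add: tree_comp_closed tree_comp_add_left tree_comp_add_right tree_comp_scale_left
      tree_comp_scale_right tree_comp_series tree_comp_parallel unit_in_tree_space)


lemma UN_const: "C \<noteq> {} \<Longrightarrow> (\<And>x. x \<in> C \<Longrightarrow> f x = K) \<Longrightarrow> (\<Union>x\<in>C. f x) = K"
  by auto

context ns_operad
begin

context
  fixes I
  assumes ideal: "operad_ideal P I"
begin

lemma submod: "submodule (I n) base_field (arity_space P n)"
  using ideal by (simp add: operad_ideal_def)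

lemma abelian_sub: "abelian_subgroup (I n) (arity_space P n)"
proof -
  interpret M: Module.module base_field "arity_space P n" by (rule vector_space)
  show ?thesis
    by (rule abelian_subgroupI3)
      (use submod[of n] in \<open>auto simp: additive_subgroup_def submodule_def M.abelian_group_axioms\<close>)
qed


abbreviation (input) cls :: "nat \<Rightarrow> 'a \<Rightarrow> 'a set" where
  "cls n x \<equiv> I n +>\<^bsub>arity_space P n\<^esub> x"

lemma ideal_subset: "I n \<subseteq> elems P n"
  using submod[of n] subgroup.subset[of "I n" "add_monoid (arity_space P n)"]
  by (simp add: submodule_def)

lemma cls_eqI:
  assumes "y \<in> cls n x" "x \<in> elems P n"
  shows "cls n y = cls n x"
proof -
  interpret abelian_subgroup "I n" "arity_space P n" by (rule abelian_sub)
  show ?thesis using a_repr_independence[OF assms a_subgroup] by simp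
qed

lemma cls_self: "x \<in> elems P n \<Longrightarrow> x \<in> cls n x"
  using abelian_subgroup.a_rcos_self[OF abelian_sub] .

lemma clsE:
  assumes "y \<in> cls n x"
  obtains h where "h \<in> I n" "y = h \<oplus>\<^bsub>arity_space P n\<^esub> x"
proof -
  have "y \<in> (\<Union>h\<in>I n. {h \<oplus>\<^bsub>arity_space P n\<^esub> x})"
    using assms by (simp only: a_r_coset_def')
  then show ?thesis using that by blast
qed

lemma clsI:
  assumes "h \<in> I n"
  shows "h \<oplus>\<^bsub>arity_space P n\<^esub> x \<in> cls n x"
  using assms by (auto simp: a_r_coset_def')

abbreviation (input) "Q \<equiv> quotient_operad P I"

lemma elems_quotient: "elems Q n = cls n ` elems P n"
  by (auto simp: quotient_operad_def quotient_module_def A_RCOSETS_def')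

lemma cls_add:
  "x \<in> elems P n \<Longrightarrow> y \<in> elems P n \<Longrightarrow>
    cls n x \<oplus>\<^bsub>arity_space Q n\<^esub> cls n y = cls n (x \<oplus>\<^bsub>arity_space P n\<^esub> y)"
  using abelian_subgroup.a_rcos_sum[OF abelian_sub]
  by (simp add: quotient_operad_def quotient_module_def)

lemma cls_zero: "\<zero>\<^bsub>arity_space Q n\<^esub> = cls n \<zero>\<^bsub>arity_space P n\<^esub>"
proof -
  interpret abelian_subgroup "I n" "arity_space P n" by (rule abelian_sub)
  show ?thesis using a_coset_add_zero[OF ideal_subset]
    by (simp add: quotient_operad_def quotient_module_def)
qed

lemma cls_smult:
  assumes x: "x \<in> elems P n"
  shows "k \<odot>\<^bsub>arity_space Q n\<^esub> cls n x = cls n (k \<odot>\<^bsub>arity_space P n\<^esub> x)"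
proof -
  interpret M: Module.module base_field "arity_space P n" by (rule vector_space)
  have "cls n (k \<odot>\<^bsub>arity_space P n\<^esub> y) = cls n (k \<odot>\<^bsub>arity_space P n\<^esub> x)" if "y \<in> cls n x" for y
  proof -
    from that obtain h where h: "h \<in> I n" "y = h \<oplus>\<^bsub>arity_space P n\<^esub> x" by (rule clsE)
    then have "k \<odot>\<^bsub>arity_space P n\<^esub> y = (k \<odot>\<^bsub>arity_space P n\<^esub> h) \<oplus>\<^bsub>arity_space P n\<^esub> (k \<odot>\<^bsub>arity_space P n\<^esub> x)"
      using x ideal_subset by (auto intro!: M.smult_r_distr)
    also have "\<dots> \<in> cls n (k \<odot>\<^bsub>arity_space P n\<^esub> x)"
      by (rule clsI) (use h submodule.smult_closed[OF submod] in auto)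
    finally show ?thesis by (rule cls_eqI) (use x in auto)
  qed
  then have "(\<Union>y\<in>cls n x. cls n (k \<odot>\<^bsub>arity_space P n\<^esub> y)) = cls n (k \<odot>\<^bsub>arity_space P n\<^esub> x)"
    using cls_self[OF x] by (intro UN_const) blast+
  then show ?thesis
    by (simp add: quotient_operad_def quotient_module_def)
qed

lemma cls_pcomp:
  assumes x: "x \<in> elems P m" and y: "y \<in> elems P n" and i: "1 \<le> i" "i \<le> m"
  shows "pcomp Q m i n (cls m x) (cls n y) = cls (m + n - 1) (pcomp P m i n x y)"
proof -
  let ?A = "arity_space P (m + n - 1)"
  interpret A: Module.module base_field ?A by (rule vector_space)
  interpret M: Module.module base_field "arity_space P m" by (rule vector_space)
  interpret N: Module.module base_field "arity_space P n" by (rule vector_space)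
  have "cls (m + n - 1) (pcomp P m i n x' y') = cls (m + n - 1) (pcomp P m i n x y)"
    if x': "x' \<in> cls m x" and y': "y' \<in> cls n y" for x' y'
  proof -
    obtain h where h: "h \<in> I m" "x' = h \<oplus>\<^bsub>arity_space P m\<^esub> x" using x' by (rule clsE)
    obtain g where g: "g \<in> I n" "y' = g \<oplus>\<^bsub>arity_space P n\<^esub> y" using y' by (rule clsE)
    have hg: "h \<in> elems P m" "g \<in> elems P n" using h g ideal_subset by auto
    have y'c: "y' \<in> elems P n" using g hg y by simp
    have c: "pcomp P m i n h y' \<in> I (m + n - 1)" "pcomp P m i n x g \<in> I (m + n - 1)"
      using ideal h g hg x y'c i unfolding operad_ideal_def by blast+
    have cc: "pcomp P m i n h y' \<in> carrier ?A" "pcomp P m i n x g \<in> carrier ?A"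
      "pcomp P m i n x y \<in> carrier ?A"
      using pcomp_closed x y y'c hg i by auto
    have "pcomp P m i n x' y' = pcomp P m i n h y' \<oplus>\<^bsub>?A\<^esub> pcomp P m i n x y'"
      unfolding h(2) using pcomp_add_left hg x y'c i by blast
    also have "pcomp P m i n x y' = pcomp P m i n x g \<oplus>\<^bsub>?A\<^esub> pcomp P m i n x y"
      unfolding g(2) using pcomp_add_right hg x y i by blast
    also have "pcomp P m i n h y' \<oplus>\<^bsub>?A\<^esub> (pcomp P m i n x g \<oplus>\<^bsub>?A\<^esub> pcomp P m i n x y) =
        (pcomp P m i n h y' \<oplus>\<^bsub>?A\<^esub> pcomp P m i n x g) \<oplus>\<^bsub>?A\<^esub> pcomp P m i n x y"
      using cc by (simp add: A.a_assoc)
    also have "\<dots> \<in> cls (m + n - 1) (pcomp P m i n x y)"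
      by (rule clsI) (use c A.submoduleE(5)[OF submod] in auto)
    finally show ?thesis by (rule cls_eqI) (use cc in auto)
  qed
  then have "(\<Union>x'\<in>cls m x. \<Union>y'\<in>cls n y. cls (m + n - 1) (pcomp P m i n x' y')) =
      cls (m + n - 1) (pcomp P m i n x y)"
    using cls_self[OF x] cls_self[OF y] by (intro UN_const) blast+
  then show ?thesis by (simp add: quotient_operad_def)
qed

lemma vector_space_quotient: "Module.module base_field (arity_space Q n)"
proof -
  interpret M: Module.module base_field "arity_space P n" by (rule vector_space)
  show ?thesis
  proof (rule moduleI)
    show "abelian_group (arity_space Q n)"
    proof (rule abelian_groupI)
      fix x assume "x \<in> elems Q n"
      then obtain a where "a \<in> elems P n" "x = cls n a" by (auto simp: elems_quotient)
      then show "\<exists>y\<in>elems Q n. y \<oplus>\<^bsub>arity_space Q n\<^esub> x = \<zero>\<^bsub>arity_space Q n\<^esub>"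
        by (intro bexI[of _ "cls n (\<ominus>\<^bsub>arity_space P n\<^esub> a)"])
          (auto simp: elems_quotient cls_add cls_zero M.l_neg)
    next
      fix x y assume "x \<in> elems Q n" "y \<in> elems Q n"
      then show "x \<oplus>\<^bsub>arity_space Q n\<^esub> y = y \<oplus>\<^bsub>arity_space Q n\<^esub> x"
        by (auto simp only: elems_quotient cls_add M.a_comm)
    qed (auto simp: elems_quotient cls_add cls_zero M.a_assoc)
  qed (auto simp: cring_base_field elems_quotient cls_add cls_smult M.smult_r_distr
      M.smult_l_distr[simplified] M.smult_assoc1[simplified] M.smult_one[simplified])
qed

theorem ns_operad_quotient: "ns_operad Q"
proof (rule ns_operad.intro)
  show "Module.module base_field (arity_space Q n)" for n by (rule vector_space_quotient)
  have sm: "k \<odot>\<^bsub>arity_space P n\<^esub> x \<in> elems P n" if "x \<in> elems P n" for k x n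
    using module.smult_closed[OF vector_space] that by auto
  have ad: "x \<oplus>\<^bsub>arity_space P n\<^esub> y \<in> elems P n" if "x \<in> elems P n" "y \<in> elems P n" for x y n
    using vector_space[of n] that by (simp add: Module.module_def abelian_group_def abelian_monoid.a_closed)
  have un: "operad_unit Q = cls 1 (operad_unit P)" by (simp add: quotient_operad_def)
  note [simp] = cls_add cls_smult cls_pcomp un
  note [simp del] = One_nat_def
  show "operad_unit Q \<in> elems Q 1" using unit_closed by (simp add: elems_quotient)
  {
    fix X Y m n i assume a: "X \<in> elems Q m" "Y \<in> elems Q n" "1 \<le> i" "i \<le> m"
    then show "pcomp Q m i n X Y \<in> elems Q (m + n - 1)"
      by (auto simp: elems_quotient intro!: imageI pcomp_closed)
    fix k
    show "pcomp Q m i n (k \<odot>\<^bsub>arity_space Q m\<^esub> X) Y = k \<odot>\<^bsub>arity_space Q (m + n - 1)\<^esub> pcomp Q m i n X Y"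
      using a by (auto simp: elems_quotient sm pcomp_smult_left pcomp_closed)
    show "pcomp Q m i n X (k \<odot>\<^bsub>arity_space Q n\<^esub> Y) = k \<odot>\<^bsub>arity_space Q (m + n - 1)\<^esub> pcomp Q m i n X Y"
      using a by (auto simp: elems_quotient sm pcomp_smult_right pcomp_closed)
  }
  {
    fix X X' Y m n i assume a: "X \<in> elems Q m" "X' \<in> elems Q m" "Y \<in> elems Q n" "1 \<le> i" "i \<le> m"
    then show "pcomp Q m i n (X \<oplus>\<^bsub>arity_space Q m\<^esub> X') Y =
        pcomp Q m i n X Y \<oplus>\<^bsub>arity_space Q (m + n - 1)\<^esub> pcomp Q m i n X' Y"
      by (auto simp: elems_quotient ad pcomp_add_left pcomp_closed)
  }
  {
    fix X Y Y' m n i assume a: "X \<in> elems Q m" "Y \<in> elems Q n" "Y' \<in> elems Q n" "1 \<le> i" "i \<le> m"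
    then show "pcomp Q m i n X (Y \<oplus>\<^bsub>arity_space Q n\<^esub> Y') =
        pcomp Q m i n X Y \<oplus>\<^bsub>arity_space Q (m + n - 1)\<^esub> pcomp Q m i n X Y'"
      by (auto simp: elems_quotient ad pcomp_add_right pcomp_closed)
  }
  {
    fix X Y Z m n l i j
    assume "X \<in> elems Q m" "Y \<in> elems Q n" "Z \<in> elems Q l" and ij: "1 \<le> i" "i \<le> m" "1 \<le> j" "j \<le> n"
    then obtain x y z where e: "X = cls m x" "Y = cls n y" "Z = cls l z"
      and c: "x \<in> elems P m" "y \<in> elems P n" "z \<in> elems P l" by (auto simp: elems_quotient)
    have b: "1 \<le> i + j - 1" "i + j - 1 \<le> m + n - 1" "m + n - 1 + l - 1 = m + (n + l - 1) - 1"
      using ij by auto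
    show "pcomp Q (m + n - 1) (i + j - 1) l (pcomp Q m i n X Y) Z =
        pcomp Q m i (n + l - 1) X (pcomp Q n j l Y Z)"
      unfolding e
      using cls_pcomp[OF c(1,2) ij(1,2)] cls_pcomp[OF c(2,3) ij(3,4)]
        cls_pcomp[OF pcomp_closed[OF c(1,2) ij(1,2)] c(3) b(1,2)]
        cls_pcomp[OF c(1) pcomp_closed[OF c(2,3) ij(3,4)] ij(1,2)] pcomp_series[OF c ij] b(3)
      by (simp only:)
  }
  {
    fix X Y Z m n l i j
    assume "X \<in> elems Q m" "Y \<in> elems Q n" "Z \<in> elems Q l" and ij: "1 \<le> i" "i < j" "j \<le> m"
    then obtain x y z where e: "X = cls m x" "Y = cls n y" "Z = cls l z"
      and c: "x \<in> elems P m" "y \<in> elems P n" "z \<in> elems P l" by (auto simp: elems_quotient)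
    have b: "1 \<le> j + n - 1" "j + n - 1 \<le> m + n - 1" "i \<le> m + l - 1" "i \<le> m" "1 \<le> j"
      "m + n - 1 + l - 1 = m + l - 1 + n - 1"
      using ij by auto
    show "pcomp Q (m + n - 1) (j + n - 1) l (pcomp Q m i n X Y) Z =
        pcomp Q (m + l - 1) i n (pcomp Q m j l X Z) Y"
      unfolding e
      using cls_pcomp[OF c(1,2) ij(1) b(4)] cls_pcomp[OF c(1,3) b(5) ij(3)]
        cls_pcomp[OF pcomp_closed[OF c(1,2) ij(1) b(4)] c(3) b(1,2)]
        cls_pcomp[OF pcomp_closed[OF c(1,3) b(5) ij(3)] c(2) ij(1) b(3)] pcomp_parallel[OF c ij] b(6)
      by (simp only:)
  }
  fix X n assume "X \<in> elems Q n"
  then obtain x where e: "X = cls n x" and c: "x \<in> elems P n" by (auto simp: elems_quotient)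
  show "pcomp Q 1 1 n (operad_unit Q) X = X"
    using cls_pcomp[OF unit_closed c, of 1] pcomp_unit_left[OF c] e un by simp
  fix i assume "1 \<le> i" "i \<le> n"
  then show "pcomp Q n i 1 X (operad_unit Q) = X"
    using cls_pcomp[OF c unit_closed, of i] pcomp_unit_right[OF c, of i] e un by simp
qed

end

lemma generated_ideal:
  assumes "\<And>n. G n \<subseteq> elems P n"
  shows "operad_ideal P (generated_ideal P G)"
proof -
  let ?S = "{I. operad_ideal P I \<and> G \<le> I}"
  have whole: "elems P \<in> ?S"
    using assms pcomp_closed module.carrier_is_submodule[OF vector_space]
    by (auto simp: operad_ideal_def le_fun_def)
  have gi: "generated_ideal P G n = (\<Inter>I\<in>?S. I n)" for n
    by (simp add: generated_ideal_def Inf_apply)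
  show ?thesis
    unfolding operad_ideal_def
  proof (intro conjI allI impI)
    fix n
    interpret M: Module.module base_field "arity_space P n" by (rule vector_space)
    have s: "submodule (I n) base_field (arity_space P n)" if "I \<in> ?S" for I
      using that by (simp add: operad_ideal_def)
    note E = M.submoduleE[OF s]
    have z: "\<zero>\<^bsub>arity_space P n\<^esub> \<in> I n" if "I \<in> ?S" for I
      using s[OF that] subgroup.one_closed[of "I n" "add_monoid (arity_space P n)"]
      by (simp add: submodule_def)
    show "submodule (generated_ideal P G n) base_field (arity_space P n)"
      unfolding gi using whole E z by (intro M.submoduleI) (auto; blast)+
  next
    fix m n i x y
    assume "1 \<le> i \<and> i \<le> m \<and> x \<in> elems P m \<and> y \<in> elems P n \<and>
      (x \<in> generated_ideal P G m \<or> y \<in> generated_ideal P G n)"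
    then show "pcomp P m i n x y \<in> generated_ideal P G (m + n - 1)"
      unfolding gi by (auto simp: operad_ideal_def)
  qed
qed

end

lemma ns_operad_quadratic:
  fixes R :: "('x tree \<Rightarrow>\<^sub>0 'k::field) set"
  assumes "R \<subseteq> carrier (tree_space X 3)"
  shows "ns_operad (quadratic_operad X R)"
proof -
  interpret ns_operad "free_operad X :: ('k, _) operad" by (rule ns_operad_free)
  show ?thesis unfolding quadratic_operad_def quadratic_ideal_def
    by (rule ns_operad_quotient, rule generated_ideal) (use assms in auto)
qed

declare One_nat_def [simp]

lemma ns_operad_Hi_dual: "ns_operad (Hi_dual c :: ('k::field, _) operad)"
  unfolding Hi_dual_def koszul_dual_def
  by (rule ns_operad_quadratic) (auto simp: annihilator_def)

lemma ns_operad_Kstar_operad: "ns_operad (Kstar_operad c :: ('k::field, _) operad)"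
  unfolding Kstar_operad_def
proof (rule ns_operad_quadratic)
  have c: "gen x \<circ>\<^bsub>i\<^esub> gen y \<in> carrier (tree_space {0..c} 3 :: ('k, _) module)"
    if "x \<le> c" "y \<le> c" "1 \<le> i" "i \<le> 2" for x y i
    using tree_comp_closed[of "gen x" "{0..c}" 2 "gen y" 2 i] that
    by (simp add: gen_def carrier_tree_space)
  have "gen b \<circ>\<^bsub>1\<^esub> gen a - gen a \<circ>\<^bsub>2\<^esub> gen b \<in> carrier (tree_space {0..c} 3 :: ('k, _) module)"
    if "b \<le> c" "a \<le> b" for a b
    using that by (intro tree_space_diff_closed c) auto
  then show "Kstar_relations c \<subseteq> (carrier (tree_space {0..c} 3) :: (nat tree \<Rightarrow>\<^sub>0 'k) set)"
    unfolding Kstar_relations_def by blast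
qed

end

theory Submission
  imports Defs
begin

text \<open>Write \<open>[u, v] = u \<circ>\<^sub>1 v - v \<circ>\<^sub>2 u\<close>. Pairing with the relations of
  \<open>Hi\<close> shows that an element of the annihilator is \<open>\<Sum> \<alpha>(x, y) [E\<^sub>x, E\<^sub>y]\<close>
  with \<open>\<alpha>(x, y)\<close> independent of \<open>x\<close> for \<open>x \<le> y\<close>, hence a combination of the
  \<open>[K\<^sub>y, E\<^sub>y]\<close> and of the \<open>[E\<^sub>x, E\<^sub>y]\<close> with \<open>y < x\<close>. Substituting
  \<open>E\<^sub>a = K\<^sub>a - K\<^sub>a\<^sub>-\<^sub>1\<close> expands these into terms \<open>[K\<^sub>b, K\<^sub>a]\<close> with
  \<open>a \<le> b\<close>; conversely each such \<open>[K\<^sub>b, K\<^sub>a]\<close> annihilates the relations. So the invertible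
  change of generators \<open>E \<leftrightarrow> K\<close>, extended to the free operad, exchanges the two ideals.\<close>

declare One_nat_def [simp del]

section \<open>Isomorphisms of quotient operads\<close>

lemma operad_hom_closed: "\<phi> \<in> operad_hom P Q \<Longrightarrow> x \<in> elems P n \<Longrightarrow> \<phi> n x \<in> elems Q n"
  by (auto simp: operad_hom_def)

lemma operad_hom_add:
  "\<phi> \<in> operad_hom P Q \<Longrightarrow> x \<in> elems P n \<Longrightarrow> y \<in> elems P n \<Longrightarrow>
    \<phi> n (x \<oplus>\<^bsub>arity_space P n\<^esub> y) = \<phi> n x \<oplus>\<^bsub>arity_space Q n\<^esub> \<phi> n y"
  by (auto simp: operad_hom_def)

lemma operad_hom_smult:
  "\<phi> \<in> operad_hom P Q \<Longrightarrow> x \<in> elems P n \<Longrightarrow>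
    \<phi> n (k \<odot>\<^bsub>arity_space P n\<^esub> x) = k \<odot>\<^bsub>arity_space Q n\<^esub> \<phi> n x"
  by (auto simp: operad_hom_def)

lemma operad_hom_unit: "\<phi> \<in> operad_hom P Q \<Longrightarrow> \<phi> 1 (operad_unit P) = operad_unit Q"
  by (auto simp: operad_hom_def)

lemma operad_hom_pcomp:
  "\<phi> \<in> operad_hom P Q \<Longrightarrow> x \<in> elems P m \<Longrightarrow> y \<in> elems P n \<Longrightarrow> 1 \<le> i \<Longrightarrow> i \<le> m \<Longrightarrow>
    \<phi> (m + n - 1) (pcomp P m i n x y) = pcomp Q m i n (\<phi> m x) (\<phi> n y)"
  by (auto simp: operad_hom_def)

text \<open>A generated ideal is accessible only through its minimality: a property of its elements
  has to be shown by exhibiting an ideal of elements that have it. Preimages under morphisms supply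
  such ideals.\<close>

lemma operad_ideal_vimage:
  assumes P: "ns_operad (P :: ('k::field, 'a) operad)" and hom: "\<phi> \<in> operad_hom P Q"
    and Q: "ns_operad Q" and J: "operad_ideal Q J"
  shows "operad_ideal P (\<lambda>n. {x \<in> elems P n. \<phi> n x \<in> J n})"
  unfolding operad_ideal_def
proof (intro conjI allI impI)
  fix n
  interpret M: Module.module base_field "arity_space P n" by (rule ns_operad.vector_space[OF P])
  interpret N: Module.module base_field "arity_space Q n" by (rule ns_operad.vector_space[OF Q])
  have S: "submodule (J n) base_field (arity_space Q n)" using J by (simp add: operad_ideal_def)
  \<comment> \<open>\<open>operad_hom\<close> asks for additivity and compatibility with scalars.
    Zero is reached as the multiple by 0 and, in the next step, negation as the multiple by
    -1.\<close>
  have zP: "\<phi> n \<zero>\<^bsub>arity_space P n\<^esub> = \<zero>\<^bsub>arity_space Q n\<^esub>"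
    using operad_hom_smult[OF hom M.zero_closed, of 0] operad_hom_closed[OF hom M.zero_closed]
      M.smult_l_null[OF M.zero_closed] N.smult_l_null by simp
  have neg: "\<ominus>\<^bsub>arity_space P n\<^esub> x = (- 1) \<odot>\<^bsub>arity_space P n\<^esub> x" if "x \<in> elems P n" for x
  proof (rule M.minus_equality)
    have "(- 1) \<odot>\<^bsub>arity_space P n\<^esub> x \<oplus>\<^bsub>arity_space P n\<^esub> x =
        (- 1 \<oplus>\<^bsub>base_field\<^esub> 1) \<odot>\<^bsub>arity_space P n\<^esub> x"
      using that M.smult_one[OF that] by (subst M.smult_l_distr) auto
    then show "(- 1) \<odot>\<^bsub>arity_space P n\<^esub> x \<oplus>\<^bsub>arity_space P n\<^esub> x = \<zero>\<^bsub>arity_space P n\<^esub>"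
      using M.smult_l_null[OF that] by simp
  qed (use that M.smult_closed in auto)
  show "submodule {x \<in> elems P n. \<phi> n x \<in> J n} base_field (arity_space P n)"
  proof (rule M.submoduleI)
    show "\<zero>\<^bsub>arity_space P n\<^esub> \<in> {x \<in> elems P n. \<phi> n x \<in> J n}"
      using zP S subgroup.one_closed[of "J n" "add_monoid (arity_space Q n)"]
      by (simp add: submodule_def)
    show "\<ominus>\<^bsub>arity_space P n\<^esub> x \<in> {x \<in> elems P n. \<phi> n x \<in> J n}"
      if "x \<in> {x \<in> elems P n. \<phi> n x \<in> J n}" for x
      using that neg[of x] operad_hom_smult[OF hom, of x n "- 1"] submodule.smult_closed[OF S]
      by (auto simp del: One_nat_def intro: M.a_inv_closed)
    show "x \<oplus>\<^bsub>arity_space P n\<^esub> y \<in> {x \<in> elems P n. \<phi> n x \<in> J n}"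
      if "x \<in> {x \<in> elems P n. \<phi> n x \<in> J n}" "y \<in> {x \<in> elems P n. \<phi> n x \<in> J n}" for x y
      using that N.submoduleE(5)[OF S] by (auto simp: operad_hom_add[OF hom])
    show "k \<odot>\<^bsub>arity_space P n\<^esub> x \<in> {x \<in> elems P n. \<phi> n x \<in> J n}"
      if "k \<in> carrier base_field" "x \<in> {x \<in> elems P n. \<phi> n x \<in> J n}" for k x
      using that submodule.smult_closed[OF S] M.smult_closed[of k x]
      by (auto simp: operad_hom_smult[OF hom])
  qed auto
next
  fix m n i x y
  assume a: "1 \<le> i \<and> i \<le> m \<and> x \<in> elems P m \<and> y \<in> elems P n \<and>
    (x \<in> {x \<in> elems P m. \<phi> m x \<in> J m} \<or> y \<in> {x \<in> elems P n. \<phi> n x \<in> J n})"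
  then have "pcomp Q m i n (\<phi> m x) (\<phi> n y) \<in> J (m + n - 1)"
    using J operad_hom_closed[OF hom] unfolding operad_ideal_def by blast
  then show "pcomp P m i n x y \<in> {x \<in> elems P (m + n - 1). \<phi> (m + n - 1) x \<in> J (m + n - 1)}"
    using a operad_hom_pcomp[OF hom, of x m y n i] ns_operad.pcomp_closed[OF P] by auto
qed

text \<open>The preimage of \<open>J\<close> is an ideal containing \<open>G\<close>, hence lies
  above the least one. So a morphism has to be tested on the generating relations only.\<close>

lemma operad_hom_generated_ideal:
  assumes "ns_operad (P :: ('k::field, 'a) operad)" "\<phi> \<in> operad_hom P Q" "ns_operad Q"
    and J: "operad_ideal Q J"
    and G: "\<And>n x. x \<in> G n \<Longrightarrow> x \<in> elems P n \<and> \<phi> n x \<in> J n"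
    and x: "x \<in> generated_ideal P G n"
  shows "\<phi> n x \<in> J n"
proof -
  have "generated_ideal P G \<le> (\<lambda>n. {x \<in> elems P n. \<phi> n x \<in> J n})"
    unfolding generated_ideal_def
    by (rule Inf_lower) (use operad_ideal_vimage[OF assms(1-4)] G in \<open>auto simp: le_fun_def\<close>)
  then show ?thesis using x by (auto simp: le_fun_def)
qed

text \<open>Elements of a quotient operad are cosets, so the induced map is taken to be direct
  image. Additivity gives one inclusion; for the other, every \<open>g\<close> in \<open>J n\<close>
  is the image of \<open>\<psi> n g\<close>, which lies in \<open>I n\<close>.\<close>

lemma operad_hom_image_coset:
  assumes P: "ns_operad (P :: ('k::field, 'a) operad)" and Q: "ns_operad Q"
    and I: "operad_ideal P I" and J: "operad_ideal Q J"
    and \<phi>: "\<phi> \<in> operad_hom P Q" and \<psi>: "\<psi> \<in> operad_hom Q P"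
    and inv: "\<And>y. y \<in> elems Q n \<Longrightarrow> \<phi> n (\<psi> n y) = y"
    and IJ: "\<And>x. x \<in> I n \<Longrightarrow> \<phi> n x \<in> J n" and JI: "\<And>y. y \<in> J n \<Longrightarrow> \<psi> n y \<in> I n"
    and x: "x \<in> elems P n"
  shows "\<phi> n ` (I n +>\<^bsub>arity_space P n\<^esub> x) = J n +>\<^bsub>arity_space Q n\<^esub> \<phi> n x"
proof (intro equalityI subsetI)
  fix z assume "z \<in> \<phi> n ` (I n +>\<^bsub>arity_space P n\<^esub> x)"
  then obtain h where h: "h \<in> I n" "z = \<phi> n (h \<oplus>\<^bsub>arity_space P n\<^esub> x)"
    by (auto elim: ns_operad.clsE[OF P I])
  then have "z = \<phi> n h \<oplus>\<^bsub>arity_space Q n\<^esub> \<phi> n x"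
    using operad_hom_add[OF \<phi> _ x] ns_operad.ideal_subset[OF P I] by blast
  then show "z \<in> J n +>\<^bsub>arity_space Q n\<^esub> \<phi> n x"
    using ns_operad.clsI[OF Q J IJ[OF h(1)]] by simp
next
  fix z assume "z \<in> J n +>\<^bsub>arity_space Q n\<^esub> \<phi> n x"
  then obtain g where g: "g \<in> J n" "z = g \<oplus>\<^bsub>arity_space Q n\<^esub> \<phi> n x"
    by (rule ns_operad.clsE[OF Q J])
  have "\<psi> n g \<in> elems P n" "g \<in> elems Q n"
    using JI[OF g(1)] ns_operad.ideal_subset[OF P I] ns_operad.ideal_subset[OF Q J] g(1) by auto
  then have "z = \<phi> n (\<psi> n g \<oplus>\<^bsub>arity_space P n\<^esub> x)"
    using g(2) operad_hom_add[OF \<phi> _ x] inv by simp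
  then show "z \<in> \<phi> n ` (I n +>\<^bsub>arity_space P n\<^esub> x)"
    using ns_operad.clsI[OF P I JI[OF g(1)]] by simp
qed

text \<open>Direct image under \<open>\<psi>\<close> inverts direct image under
  \<open>\<phi>\<close> on cosets. Every operation of the quotients is carried out on
  representatives, where the claim is that \<open>\<phi>\<close> is a morphism.\<close>

lemma operad_iso_quotient:
  assumes P: "ns_operad (P :: ('k::field, 'a) operad)" and Q: "ns_operad Q"
    and I: "operad_ideal P I" and J: "operad_ideal Q J"
    and \<phi>: "\<phi> \<in> operad_hom P Q" and \<psi>: "\<psi> \<in> operad_hom Q P"
    and inv1: "\<And>n x. x \<in> elems P n \<Longrightarrow> \<psi> n (\<phi> n x) = x"
    and inv2: "\<And>n y. y \<in> elems Q n \<Longrightarrow> \<phi> n (\<psi> n y) = y"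
    and IJ: "\<And>n x. x \<in> I n \<Longrightarrow> \<phi> n x \<in> J n" and JI: "\<And>n y. y \<in> J n \<Longrightarrow> \<psi> n y \<in> I n"
  shows "(\<lambda>n. (`) (\<phi> n)) \<in> operad_iso (quotient_operad P I) (quotient_operad Q J)"
proof -
  have im: "\<phi> n ` (I n +>\<^bsub>arity_space P n\<^esub> x) = J n +>\<^bsub>arity_space Q n\<^esub> \<phi> n x"
    if "x \<in> elems P n" for x n
    by (rule operad_hom_image_coset[OF P Q I J \<phi> \<psi> inv2 IJ JI that])
  have im': "\<psi> n ` (J n +>\<^bsub>arity_space Q n\<^esub> x) = I n +>\<^bsub>arity_space P n\<^esub> \<psi> n x"
    if "x \<in> elems Q n" for x n
    by (rule operad_hom_image_coset[OF Q P J I \<psi> \<phi> inv1 JI IJ that])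
  note c = operad_hom_closed[OF \<phi>] and c' = operad_hom_closed[OF \<psi>]
  note eP = ns_operad.elems_quotient[OF P I] and eQ = ns_operad.elems_quotient[OF Q J]
  have add: "x \<oplus>\<^bsub>arity_space P n\<^esub> y \<in> elems P n" if "x \<in> elems P n" "y \<in> elems P n" for x y n
    using ns_operad.vector_space[OF P, of n] that
    by (simp add: Module.module_def abelian_group_def abelian_monoid.a_closed)
  have sm: "k \<odot>\<^bsub>arity_space P n\<^esub> x \<in> elems P n" if "x \<in> elems P n" for x n k
    using module.smult_closed[OF ns_operad.vector_space[OF P]] that by auto
  show ?thesis
    unfolding operad_iso_def operad_hom_def
  proof (intro CollectI conjI allI ballI impI)
    fix n
    show "(`) (\<phi> n) \<in> elems (quotient_operad P I) n \<rightarrow> elems (quotient_operad Q J) n"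
      by (auto simp: eP eQ im c)
    show "bij_betw ((`) (\<phi> n)) (elems (quotient_operad P I) n) (elems (quotient_operad Q J) n)"
    proof (rule bij_betw_byWitness[where f' = "(`) (\<psi> n)"])
      show "\<forall>X\<in>elems (quotient_operad P I) n. \<psi> n ` \<phi> n ` X = X"
        unfolding eP ball_simps by (intro ballI) (simp only: im im' c inv1)
      show "\<forall>Y\<in>elems (quotient_operad Q J) n. \<phi> n ` \<psi> n ` Y = Y"
        unfolding eQ ball_simps by (intro ballI) (simp only: im im' c' inv2)
    qed (auto simp: eP eQ im im' c c')
    fix X assume "X \<in> elems (quotient_operad P I) n"
    then obtain x where x: "x \<in> elems P n" "X = I n +>\<^bsub>arity_space P n\<^esub> x" by (auto simp: eP)
    show "\<phi> n ` (k \<odot>\<^bsub>arity_space (quotient_operad P I) n\<^esub> X) =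
        k \<odot>\<^bsub>arity_space (quotient_operad Q J) n\<^esub> (\<phi> n ` X)" for k
      by (simp only: x im sm c ns_operad.cls_smult[OF P I] ns_operad.cls_smult[OF Q J]
          operad_hom_smult[OF \<phi>])
    fix Y assume "Y \<in> elems (quotient_operad P I) n"
    then obtain y where y: "y \<in> elems P n" "Y = I n +>\<^bsub>arity_space P n\<^esub> y" by (auto simp: eP)
    show "\<phi> n ` (X \<oplus>\<^bsub>arity_space (quotient_operad P I) n\<^esub> Y) =
        (\<phi> n ` X) \<oplus>\<^bsub>arity_space (quotient_operad Q J) n\<^esub> (\<phi> n ` Y)"
      by (simp only: x y im add c ns_operad.cls_add[OF P I] ns_operad.cls_add[OF Q J]
          operad_hom_add[OF \<phi>])
  next
    show "\<phi> 1 ` operad_unit (quotient_operad P I) = operad_unit (quotient_operad Q J)"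
      using im[OF ns_operad.unit_closed[OF P]] operad_hom_unit[OF \<phi>]
      by (simp add: quotient_operad_def)
  next
    fix m n i X Y
    assume X: "X \<in> elems (quotient_operad P I) m" and Y: "Y \<in> elems (quotient_operad P I) n"
      and i: "1 \<le> i \<and> i \<le> m"
    from X obtain x where x: "x \<in> elems P m" "X = I m +>\<^bsub>arity_space P m\<^esub> x" by (auto simp: eP)
    from Y obtain y where y: "y \<in> elems P n" "Y = I n +>\<^bsub>arity_space P n\<^esub> y" by (auto simp: eP)
    note i' = conjunct1[OF i] conjunct2[OF i]
    show "\<phi> (m + n - 1) ` pcomp (quotient_operad P I) m i n X Y =
        pcomp (quotient_operad Q J) m i n (\<phi> m ` X) (\<phi> n ` Y)"
      unfolding x(2) y(2) ns_operad.cls_pcomp[OF P I x(1) y(1) i'] im[OF x(1)] im[OF y(1)]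
        im[OF ns_operad.pcomp_closed[OF P x(1) y(1) i']]
        ns_operad.cls_pcomp[OF Q J c[OF x(1)] c[OF y(1)] i'] operad_hom_pcomp[OF \<phi> x(1) y(1) i'] ..
  qed
qed

section \<open>Substitution in free operads\<close>

text \<open>The right subtree is inserted first because this leaves the left input of the root at
  position 1; in the other order the right input would have moved to position
  \<open>1 + size1 l\<close>.\<close>

primrec tree_eval :: "('x \<Rightarrow> 'y tree \<Rightarrow>\<^sub>0 'k::field) \<Rightarrow> 'x tree \<Rightarrow> ('y tree \<Rightarrow>\<^sub>0 'k)" where
  "tree_eval \<sigma> Leaf = Poly_Mapping.single Leaf 1"
| "tree_eval \<sigma> (Node l a r) = (\<sigma> a \<circ>\<^bsub>2\<^esub> tree_eval \<sigma> r) \<circ>\<^bsub>1\<^esub> tree_eval \<sigma> l"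

text \<open>The linear extension of \<open>tree_eval\<close>. When all \<open>\<sigma> a\<close>
  have arity 2, this is the morphism of free operads that sends the generator \<open>a\<close> to
  \<open>\<sigma> a\<close>.\<close>

definition tree_subst ::
    "('x \<Rightarrow> 'y tree \<Rightarrow>\<^sub>0 'k::field) \<Rightarrow> ('x tree \<Rightarrow>\<^sub>0 'k) \<Rightarrow> ('y tree \<Rightarrow>\<^sub>0 'k)" where
  "tree_subst \<sigma> f =
    (\<Sum>t\<in>Poly_Mapping.keys f. Poly_Mapping.map ((*) (Poly_Mapping.lookup f t)) (tree_eval \<sigma> t))"

lemma tree_space_zero: "0 \<in> carrier (tree_space X n)"
  by (simp add: carrier_tree_space)

lemma tree_space_scale:
  "f \<in> carrier (tree_space X n) \<Longrightarrow> Poly_Mapping.map ((*) k) f \<in> carrier (tree_space X n)"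
  by (auto simp: carrier_tree_space_lookup)

lemma scale_add_left: "Poly_Mapping.map ((*) (k + k' :: 'k::field)) f =
    Poly_Mapping.map ((*) k) f + Poly_Mapping.map ((*) k') f"
  by (rule poly_mapping_eqI) (simp add: lookup_add algebra_simps)

lemma scale_scale: "Poly_Mapping.map ((*) (k :: 'k::field)) (Poly_Mapping.map ((*) k') f) =
    Poly_Mapping.map ((*) (k * k')) f"
  by (rule poly_mapping_eqI) simp

lemma scale_zero_left: "Poly_Mapping.map ((*) (0 :: 'k::field)) f = 0"
  by (rule poly_mapping_eqI) simp

lemma scale_one_left: "Poly_Mapping.map ((*) (1 :: 'k::field)) f = f"
  by (rule poly_mapping_eqI) simp

lemma tree_subst_superset:
  assumes "finite A" "Poly_Mapping.keys f \<subseteq> A"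
  shows "tree_subst \<sigma> f = (\<Sum>t\<in>A. Poly_Mapping.map ((*) (Poly_Mapping.lookup f t)) (tree_eval \<sigma> t))"
  unfolding tree_subst_def
  by (rule sum.mono_neutral_left) (use assms in \<open>auto simp: in_keys_iff scale_zero_left\<close>)

lemma tree_subst_0 [simp]: "tree_subst \<sigma> 0 = 0"
  by (simp add: tree_subst_def)

lemma tree_subst_add: "tree_subst \<sigma> (f + g) = tree_subst \<sigma> f + tree_subst \<sigma> g"
proof -
  let ?A = "Poly_Mapping.keys f \<union> Poly_Mapping.keys g"
  have "Poly_Mapping.keys (f + g) \<subseteq> ?A" by (rule Poly_Mapping.keys_add)
  then show ?thesis
    by (simp add: tree_subst_superset[of ?A] lookup_add scale_add_left sum.distrib)
qed

lemma tree_subst_diff: "tree_subst \<sigma> (f - g) = tree_subst \<sigma> f - tree_subst \<sigma> g"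
  using tree_subst_add[of \<sigma> "f - g" g] by (simp add: algebra_simps)

lemma tree_subst_sum: "tree_subst \<sigma> (sum F A) = (\<Sum>a\<in>A. tree_subst \<sigma> (F a))"
  by (induction A rule: infinite_finite_induct) (simp_all add: tree_subst_add)

lemma tree_subst_scale:
  "tree_subst \<sigma> (Poly_Mapping.map ((*) k) f) = Poly_Mapping.map ((*) k) (tree_subst \<sigma> f)"
  using keys_scale[of k f]
  by (simp add: tree_subst_superset[of "Poly_Mapping.keys f"] scale_sum scale_scale)

lemma tree_subst_single:
  "tree_subst \<sigma> (Poly_Mapping.single t k) = Poly_Mapping.map ((*) k) (tree_eval \<sigma> t)"
  by (simp add: tree_subst_superset[of "{t}"])

context
  fixes \<sigma> :: "'x \<Rightarrow> 'y tree \<Rightarrow>\<^sub>0 'k::field" and X Y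
  assumes \<sigma>: "\<And>a. a \<in> X \<Longrightarrow> \<sigma> a \<in> carrier (tree_space Y 2)"
begin

lemma tree_eval_closed: "set_tree t \<subseteq> X \<Longrightarrow> tree_eval \<sigma> t \<in> carrier (tree_space Y (size1 t))"
proof (induction t)
  case (Node l a r)
  then have "\<sigma> a \<circ>\<^bsub>2\<^esub> tree_eval \<sigma> r \<in> carrier (tree_space Y (2 + size1 r - 1))"
    by (intro tree_comp_closed \<sigma>) auto
  then have "(\<sigma> a \<circ>\<^bsub>2\<^esub> tree_eval \<sigma> r) \<circ>\<^bsub>1\<^esub> tree_eval \<sigma> l
      \<in> carrier (tree_space Y (2 + size1 r - 1 + size1 l - 1))"
    using Node by (intro tree_comp_closed[of _ _ "2 + size1 r - 1"]) auto
  then show ?case by (simp add: add.commute)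
qed (use unit_in_tree_space in simp)

text \<open>Each case is an operad axiom in the target: the unit axiom for a leaf, the series axiom
  for grafting into the left subtree, and the parallel followed by the series axiom for the right
  subtree.\<close>

lemma tree_eval_graft:
  assumes s: "set_tree s \<subseteq> X"
  shows "set_tree t \<subseteq> X \<Longrightarrow> 1 \<le> i \<Longrightarrow> i \<le> size1 t \<Longrightarrow>
    tree_eval \<sigma> (graft t i s) = tree_eval \<sigma> t \<circ>\<^bsub>i\<^esub> tree_eval \<sigma> s"
proof (induction t arbitrary: i)
  case Leaf
  interpret ns_operad "free_operad Y :: ('k, _) operad" by (rule ns_operad_free)
  show ?case using Leaf pcomp_unit_left[of "tree_eval \<sigma> s" "size1 s"] tree_eval_closed[OF s] by simp
next
  case (Node l a r)
  let ?L = "tree_eval \<sigma> l" and ?R = "tree_eval \<sigma> r" and ?S = "tree_eval \<sigma> s"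
  have L: "?L \<in> carrier (tree_space Y (size1 l))" and R: "?R \<in> carrier (tree_space Y (size1 r))"
    and S: "?S \<in> carrier (tree_space Y (size1 s))" and a: "\<sigma> a \<in> carrier (tree_space Y 2)"
    using tree_eval_closed Node.prems s \<sigma> by auto
  have aR: "\<sigma> a \<circ>\<^bsub>2\<^esub> ?R \<in> carrier (tree_space Y (Suc (size1 r)))"
    using tree_comp_closed[OF a R, of 2] by simp
  show ?case
  proof (cases "i \<le> size1 l")
    case True
    then show ?thesis
      using Node tree_comp_series[OF aR L S, of 1 i] by simp
  next
    case False
    \<comment> \<open>Leaf \<open>i\<close> of the whole tree is leaf \<open>i - size1 l\<close> of
      \<open>r\<close>. Before the left subtree is inserted its position is one higher, since
      position 1 is the left input of the root.\<close>
    have 1: "(\<sigma> a \<circ>\<^bsub>2\<^esub> ?R) \<circ>\<^bsub>Suc (i - size1 l)\<^esub> ?S = \<sigma> a \<circ>\<^bsub>2\<^esub> (?R \<circ>\<^bsub>i - size1 l\<^esub> ?S)"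
      using tree_comp_series[OF a R S, of 2 "i - size1 l"] False Node.prems by simp
    \<comment> \<open>Inserting \<open>?L\<close> at position 1 shifts later positions by
      \<open>size1 l - 1\<close>, which turns \<open>Suc (i - size1 l)\<close> into
      \<open>i\<close>.\<close>
    have 2: "((\<sigma> a \<circ>\<^bsub>2\<^esub> ?R) \<circ>\<^bsub>1\<^esub> ?L) \<circ>\<^bsub>i\<^esub> ?S = ((\<sigma> a \<circ>\<^bsub>2\<^esub> ?R) \<circ>\<^bsub>Suc (i - size1 l)\<^esub> ?S) \<circ>\<^bsub>1\<^esub> ?L"
      using tree_comp_parallel[OF aR L S, of 1 "Suc (i - size1 l)"] False Node.prems by simp
    have 3: "tree_eval \<sigma> (graft r (i - size1 l) s) = ?R \<circ>\<^bsub>i - size1 l\<^esub> ?S"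
      using Node False by simp
    show ?thesis using 1 2 3 False by simp
  qed
qed

lemma tree_subst_closed:
  "f \<in> carrier (tree_space X n) \<Longrightarrow> tree_subst \<sigma> f \<in> carrier (tree_space Y n)"
proof (induction rule: tree_space_induct)
  case (single t a)
  then show ?case using tree_eval_closed[of t] by (auto simp: tree_subst_single intro: tree_space_scale)
qed (auto simp: tree_subst_add tree_space_add_closed tree_space_zero)

text \<open>Both sides are bilinear in \<open>f\<close> and \<open>g\<close>; on single trees the
  equation is \<open>tree_eval_graft\<close>.\<close>

lemma tree_subst_comp:
  assumes "f \<in> carrier (tree_space X m)" "g \<in> carrier (tree_space X n)" "1 \<le> i" "i \<le> m"
  shows "tree_subst \<sigma> (f \<circ>\<^bsub>i\<^esub> g) = tree_subst \<sigma> f \<circ>\<^bsub>i\<^esub> tree_subst \<sigma> g"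
  using assms(1)
proof (induction rule: tree_space_induct)
  case (single t a)
  note t = this
  show ?case using assms(2)
  proof (induction rule: tree_space_induct)
    case (single s b)
    then show ?case
      using t assms tree_eval_graft[of s t i]
      by (simp add: tree_comp_single tree_subst_single tree_comp_scale_left tree_comp_scale_right
          scale_scale mult.commute)
  qed (auto simp: tree_comp_add_right tree_subst_add)
qed (auto simp: tree_comp_add_left tree_subst_add)

lemma tree_subst_hom: "(\<lambda>n. tree_subst \<sigma>) \<in> operad_hom (free_operad X) (free_operad Y)"
  unfolding operad_hom_def
  by (auto simp: tree_subst_add tree_subst_scale tree_subst_closed tree_subst_comp
      tree_subst_single scale_one_left)

lemma tree_subst_gen:
  assumes "a \<in> X"
  shows "tree_subst \<sigma> (gen a) = \<sigma> a"
proof -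
  interpret ns_operad "free_operad Y :: ('k, _) operad" by (rule ns_operad_free)
  show ?thesis
    using pcomp_unit_right[of "\<sigma> a" 2 2] pcomp_unit_right[of "\<sigma> a" 2 1] \<sigma>[OF assms]
    by (simp add: gen_def tree_subst_single scale_one_left)
qed

end

lemma gen_closed: "a \<in> X \<Longrightarrow> gen a \<in> carrier (tree_space X 2)"
  by (simp add: gen_def carrier_tree_space)

text \<open>A composite of two substitutions respects compositions and units, and every tree is
  built from corollas, so being the identity can be checked on the generators.\<close>

lemma tree_subst_inverse:
  fixes \<sigma> :: "'x \<Rightarrow> 'y tree \<Rightarrow>\<^sub>0 'k::field"
  assumes \<sigma>: "\<And>a. a \<in> X \<Longrightarrow> \<sigma> a \<in> carrier (tree_space Y 2)"
    and \<tau>: "\<And>a. a \<in> Y \<Longrightarrow> \<tau> a \<in> carrier (tree_space X 2)"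
    and inv: "\<And>a. a \<in> X \<Longrightarrow> tree_subst \<tau> (\<sigma> a) = gen a"
    and f: "f \<in> carrier (tree_space X n)"
  shows "tree_subst \<tau> (tree_subst \<sigma> f) = f"
  using f
proof (induction rule: tree_space_induct)
  case (single t k)
  have "tree_subst \<tau> (tree_eval \<sigma> t) = Poly_Mapping.single t 1"
    using single(1)
  proof (induction t)
    case Leaf
    then show ?case by (simp add: tree_subst_single scale_one_left)
  next
    case (Node l a r)
    have L: "tree_eval \<sigma> l \<in> carrier (tree_space Y (size1 l))"
      and R: "tree_eval \<sigma> r \<in> carrier (tree_space Y (size1 r))" and a: "\<sigma> a \<in> carrier (tree_space Y 2)"
      using tree_eval_closed[of X \<sigma> Y, OF \<sigma>] Node.prems \<sigma> by auto
    have aR: "\<sigma> a \<circ>\<^bsub>2\<^esub> tree_eval \<sigma> r \<in> carrier (tree_space Y (Suc (size1 r)))"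
      using tree_comp_closed[OF a R, of 2] by simp
    have 1: "tree_subst \<tau> ((\<sigma> a \<circ>\<^bsub>2\<^esub> tree_eval \<sigma> r) \<circ>\<^bsub>1\<^esub> tree_eval \<sigma> l) =
        tree_subst \<tau> (\<sigma> a \<circ>\<^bsub>2\<^esub> tree_eval \<sigma> r) \<circ>\<^bsub>1\<^esub> tree_subst \<tau> (tree_eval \<sigma> l)"
      by (rule tree_subst_comp[OF \<tau> aR L]) auto
    have 2: "tree_subst \<tau> (\<sigma> a \<circ>\<^bsub>2\<^esub> tree_eval \<sigma> r) =
        tree_subst \<tau> (\<sigma> a) \<circ>\<^bsub>2\<^esub> tree_subst \<tau> (tree_eval \<sigma> r)"
      by (rule tree_subst_comp[OF \<tau> a R]) auto
    show ?case using Node inv[of a] by (simp add: 1[simplified] 2[simplified] gen_def tree_comp_single)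
  qed
  then show ?case by (simp add: tree_subst_single tree_subst_scale scale_single)
qed (simp_all add: tree_subst_add)

section \<open>Bilinearity of composition and subspaces of the tree spaces\<close>

lemma tree_comp_diff_left: "(f - f') \<circ>\<^bsub>i\<^esub> g = f \<circ>\<^bsub>i\<^esub> g - f' \<circ>\<^bsub>i\<^esub> g"
  using tree_comp_add_left[of "f - f'" f' i g] by (simp add: algebra_simps)

lemma tree_comp_diff_right: "f \<circ>\<^bsub>i\<^esub> (g - g') = f \<circ>\<^bsub>i\<^esub> g - f \<circ>\<^bsub>i\<^esub> g'"
  using tree_comp_add_right[of f i "g - g'" g'] by (simp add: algebra_simps)

lemma tree_comp_sum_left: "sum F A \<circ>\<^bsub>i\<^esub> g = (\<Sum>a\<in>A. F a \<circ>\<^bsub>i\<^esub> g)"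
  by (induction A rule: infinite_finite_induct) (simp_all add: tree_comp_add_left)

lemma tree_comp_sum_right: "f \<circ>\<^bsub>i\<^esub> sum G A = (\<Sum>a\<in>A. f \<circ>\<^bsub>i\<^esub> G a)"
  by (induction A rule: infinite_finite_induct) (simp_all add: tree_comp_add_right)

lemma tree_space_sum:
  "(\<And>a. a \<in> A \<Longrightarrow> F a \<in> carrier (tree_space X n)) \<Longrightarrow> sum F A \<in> carrier (tree_space X n)"
  by (induction A rule: infinite_finite_induct) (simp_all add: tree_space_zero tree_space_add_closed)

lemma submodule_tree_space:
  assumes "submodule H base_field (tree_space X n :: ('k::field, _) module)"
  shows submodule_tree_space_zero: "0 \<in> H"
    and submodule_tree_space_add: "x \<in> H \<Longrightarrow> y \<in> H \<Longrightarrow> x + y \<in> H"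
    and submodule_tree_space_scale: "x \<in> H \<Longrightarrow> Poly_Mapping.map ((*) k) x \<in> H"
    and submodule_tree_space_diff: "x \<in> H \<Longrightarrow> y \<in> H \<Longrightarrow> x - y \<in> H"
    and submodule_tree_space_sum: "(\<And>a. a \<in> A \<Longrightarrow> F a \<in> H) \<Longrightarrow> sum F A \<in> H"
proof -
  interpret Module.module base_field "tree_space X n :: ('k, _) module" by (rule module_tree_space)
  show zero: "0 \<in> H"
    using assms subgroup.one_closed[of H "add_monoid (tree_space X n)"] by (simp add: submodule_def)
  show add: "x + y \<in> H" if "x \<in> H" "y \<in> H" for x y
    using submoduleE(5)[OF assms] that by simp
  show scale: "Poly_Mapping.map ((*) k) x \<in> H" if "x \<in> H" for x k
    using submodule.smult_closed[OF assms] that by simp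
  show "x - y \<in> H" if "x \<in> H" "y \<in> H"
  proof -
    have "x - y = x + Poly_Mapping.map ((*) (- 1)) y"
      by (rule poly_mapping_eqI) (simp add: lookup_add lookup_minus)
    then show ?thesis using add[OF that(1) scale[OF that(2), of "- 1"]] by (simp only:)
  qed
  show "sum F A \<in> H" if "\<And>a. a \<in> A \<Longrightarrow> F a \<in> H"
    using that by (induction A rule: infinite_finite_induct) (simp_all add: zero add)
qed

section \<open>The annihilator of the relations\<close>

abbreviation left_comb :: "'x \<Rightarrow> 'x \<Rightarrow> 'x tree" where
  "left_comb x y \<equiv> Node (corolla y) x Leaf"

abbreviation right_comb :: "'x \<Rightarrow> 'x \<Rightarrow> 'x tree" where
  "right_comb x y \<equiv> Node Leaf x (corolla y)"

lemma gen_comp_1: "gen x \<circ>\<^bsub>1\<^esub> gen y = Poly_Mapping.single (left_comb x y) 1"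
  by (simp add: gen_def tree_comp_single)

lemma gen_comp_2: "gen x \<circ>\<^bsub>2\<^esub> gen y = Poly_Mapping.single (right_comb x y) 1"
  by (simp add: gen_def tree_comp_single)

lemma size1_eq_1: "size1 t = 1 \<longleftrightarrow> t = Leaf"
  using size1_pos by (cases t) (auto simp: size1_size)

lemma size1_eq_2: "size1 t = 2 \<longleftrightarrow> (\<exists>y. t = corolla y)"
  by (cases t) (auto simp: size1_size)

text \<open>An element of arity 3 is thus determined by its coefficients at the two kinds of combs,
  which is how equalities in arity 3 are checked below.\<close>

lemma size1_eq_3: "size1 t = 3 \<longleftrightarrow> (\<exists>x y. t = left_comb x y \<or> t = right_comb x y)"
proof (cases t)
  case (Node l x r)
  have "size1 t = 3 \<longleftrightarrow> size1 l = 2 \<and> size1 r = 1 \<or> size1 l = 1 \<and> size1 r = 2"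
    using Node size1_pos[of l] size1_pos[of r] by auto
  then show ?thesis using Node by (auto simp: size1_eq_1 size1_eq_2)
qed simp

lemma pairing_add: "pairing X f (g + h) = pairing X f g + pairing X f h"
  unfolding pairing_def sum.distrib[symmetric]
  by (intro sum.cong refl) (simp add: lookup_add algebra_simps)

lemma pairing_diff: "pairing X f (g - h) = pairing X f g - pairing X f h"
  using pairing_add[of X f "g - h" h] by simp

lemma pairing_scale: "pairing X f (Poly_Mapping.map ((*) k) g) = k * pairing X f g"
  unfolding pairing_def sum_distrib_left
  by (intro sum.cong refl) (simp add: algebra_simps)

lemma sum_sum_single:
  assumes "finite A" "finite B" "x \<in> A" "y \<in> B"
  shows "(\<Sum>x'\<in>A. \<Sum>y'\<in>B. if x' = x \<and> y' = y then F x' y' else 0) = F x y"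
proof -
  have "(\<Sum>x'\<in>A. \<Sum>y'\<in>B. if x' = x \<and> y' = y then F x' y' else 0) =
      (\<Sum>x'\<in>A. if x' = x then \<Sum>y'\<in>B. if y' = y then F x' y' else 0 else 0)"
    by (intro sum.cong refl) auto
  then show ?thesis using assms by simp
qed

text \<open>The combs are pairwise orthogonal, so pairing with one of them reads off a single
  coefficient; the minus is the sign of the pairing at index 2.\<close>

lemma pairing_gen_comp:
  assumes "finite X" "x \<in> X" "y \<in> X"
  shows "pairing X f (gen x \<circ>\<^bsub>1\<^esub> gen y) = Poly_Mapping.lookup f (left_comb x y)"
    and "pairing X f (gen x \<circ>\<^bsub>2\<^esub> gen y) = - Poly_Mapping.lookup f (right_comb x y)"
proof -
  have "pairing X f (gen x \<circ>\<^bsub>1\<^esub> gen y) =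
      (\<Sum>x'\<in>X. \<Sum>y'\<in>X. if x' = x \<and> y' = y then Poly_Mapping.lookup f (left_comb x' y') else 0)"
    unfolding pairing_def gen_comp_1
    by (intro sum.cong refl) (auto simp: lookup_single when_def)
  then show "pairing X f (gen x \<circ>\<^bsub>1\<^esub> gen y) = Poly_Mapping.lookup f (left_comb x y)"
    using sum_sum_single[of X X x y] assms by simp
  have "pairing X f (gen x \<circ>\<^bsub>2\<^esub> gen y) =
      (\<Sum>x'\<in>X. \<Sum>y'\<in>X. if x' = x \<and> y' = y then - Poly_Mapping.lookup f (right_comb x' y') else 0)"
    unfolding pairing_def gen_comp_2
    by (intro sum.cong refl) (auto simp: lookup_single when_def)
  then show "pairing X f (gen x \<circ>\<^bsub>2\<^esub> gen y) = - Poly_Mapping.lookup f (right_comb x y)"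
    using sum_sum_single[of X X x y] assms by simp
qed

lemma submodule_pairing_kernel:
  "submodule {r \<in> carrier (tree_space X 3). pairing X f r = 0} base_field
    (tree_space X 3 :: ('k::field, _) module)"
proof -
  interpret Module.module base_field "tree_space X 3 :: ('k, _) module" by (rule module_tree_space)
  note whole = module.carrier_is_submodule[OF module_tree_space]
  have "\<ominus>\<^bsub>tree_space X 3\<^esub> x = - x" if "x \<in> carrier (tree_space X 3 :: ('k, _) module)" for x
    using submodule_tree_space_diff[OF whole submodule_tree_space_zero[OF whole] that] that
    by (intro minus_equality) auto
  moreover have "pairing X f (- x) = - pairing X f x" for x
    using pairing_diff[of X f 0 x] by (simp add: pairing_def)
  ultimately show ?thesis
    using a_inv_closed
    by (intro submoduleI)
      (auto simp: tree_space_zero tree_space_add_closed tree_space_scale pairing_add pairing_scale,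
       auto simp: pairing_def)
qed

lemma gen_comp_closed:
  assumes "x \<in> X" "y \<in> X"
  shows "gen x \<circ>\<^bsub>1\<^esub> gen y \<in> carrier (tree_space X 3)" "gen x \<circ>\<^bsub>2\<^esub> gen y \<in> carrier (tree_space X 3)"
  unfolding gen_comp_1 gen_comp_2 using assms by (auto simp: carrier_tree_space)

text \<open>The elements orthogonal to a fixed \<open>f\<close> form a subspace. If it contains
  \<open>S\<close>, it contains the span of \<open>S\<close>.\<close>

lemma annihilator_hull:
  fixes S :: "('x tree \<Rightarrow>\<^sub>0 'k::field) set"
  assumes "S \<subseteq> carrier (tree_space X 3)"
  shows "annihilator X ((\<lambda>H. submodule H base_field (tree_space X 3)) hull S) = annihilator X S"
proof -
  have "pairing X f r = 0"
    if f: "\<forall>r\<in>S. pairing X f r = 0"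
      and r: "r \<in> (\<lambda>H. submodule H base_field (tree_space X 3)) hull S" for f r
  proof -
    have "(\<lambda>H. submodule H base_field (tree_space X 3)) hull S
        \<subseteq> {r \<in> carrier (tree_space X 3). pairing X f r = 0}"
      by (rule hull_minimal[where S = "\<lambda>H. submodule H base_field (tree_space X 3)",
            OF _ submodule_pairing_kernel]) (use assms f in auto)
    then show ?thesis using r by auto
  qed
  then show ?thesis
    using hull_subset[of S "\<lambda>H. submodule H base_field (tree_space X 3)"]
    unfolding annihilator_def by blast
qed

text \<open>Orthogonality has to be tested only on the spanning relations. The minus sign in each
  relation cancels the one that the pairing puts on right combs, which leaves sums of two
  coefficients.\<close>

lemma annihilator_Hi_relations:
  fixes f :: "nat tree \<Rightarrow>\<^sub>0 'k::field"
  shows "f \<in> annihilator {0..c} (Hi_relations c) \<longleftrightarrow>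
    f \<in> carrier (tree_space {0..c} 3) \<and>
    (\<forall>a a' b. a \<le> b \<and> a' \<le> b \<and> b \<le> c \<longrightarrow>
      Poly_Mapping.lookup f (left_comb a b) + Poly_Mapping.lookup f (right_comb b a') = 0) \<and>
    (\<forall>a b. a < b \<and> b \<le> c \<longrightarrow>
      Poly_Mapping.lookup f (left_comb b a) + Poly_Mapping.lookup f (right_comb a b) = 0)"
proof -
  let ?S1 = "{gen a \<circ>\<^bsub>1\<^esub> gen b - gen b \<circ>\<^bsub>2\<^esub> gen a' | a a' b. a \<le> b \<and> a' \<le> b \<and> b \<le> c}
    :: (nat tree \<Rightarrow>\<^sub>0 'k) set"
  let ?S2 = "{gen b \<circ>\<^bsub>1\<^esub> gen a - gen a \<circ>\<^bsub>2\<^esub> gen b | a b. a < b \<and> b \<le> c} :: (nat tree \<Rightarrow>\<^sub>0 'k) set"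
  have "?S1 \<union> ?S2 \<subseteq> carrier (tree_space {0..c} 3)"
    by (auto intro!: tree_space_diff_closed gen_comp_closed)
  then have "annihilator {0..c} (Hi_relations c) = annihilator {0..c} (?S1 \<union> ?S2)"
    unfolding Hi_relations_def by (rule annihilator_hull)
  moreover have "(\<forall>r\<in>?S1. pairing {0..c} f r = 0) \<longleftrightarrow>
    (\<forall>a a' b. a \<le> b \<and> a' \<le> b \<and> b \<le> c \<longrightarrow> pairing {0..c} f (gen a \<circ>\<^bsub>1\<^esub> gen b - gen b \<circ>\<^bsub>2\<^esub> gen a') = 0)"
    by blast
  moreover have "(\<forall>r\<in>?S2. pairing {0..c} f r = 0) \<longleftrightarrow>
    (\<forall>a b. a < b \<and> b \<le> c \<longrightarrow> pairing {0..c} f (gen b \<circ>\<^bsub>1\<^esub> gen a - gen a \<circ>\<^bsub>2\<^esub> gen b) = 0)"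
    by blast
  ultimately show ?thesis
    by (simp add: annihilator_def ball_Un pairing_diff pairing_gen_comp cong: conj_cong imp_cong)
qed

section \<open>The bracket and the change of generators\<close>

text \<open>The bracket [u, v] of the introduction. The defining relations of
  \<open>Kstar_operad\<close> are the brackets of generators \<open>b\<close> and \<open>a\<close>
  with \<open>a \<le> b\<close>, and bilinearity makes them easy to transform.\<close>

definition skew :: "('x tree \<Rightarrow>\<^sub>0 'k::field) \<Rightarrow> ('x tree \<Rightarrow>\<^sub>0 'k) \<Rightarrow> ('x tree \<Rightarrow>\<^sub>0 'k)" where
  "skew u v = u \<circ>\<^bsub>1\<^esub> v - v \<circ>\<^bsub>2\<^esub> u"

lemma skew_diff_left: "skew (u - u') v = skew u v - skew u' v"
  by (simp add: skew_def tree_comp_diff_left tree_comp_diff_right)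

lemma skew_diff_right: "skew u (v - v') = skew u v - skew u v'"
  by (simp add: skew_def tree_comp_diff_left tree_comp_diff_right)

lemma skew_sum_left: "skew (sum F A) v = (\<Sum>a\<in>A. skew (F a) v)"
  by (simp add: skew_def tree_comp_sum_left tree_comp_sum_right sum_subtractf)

lemma skew_closed:
  assumes "u \<in> carrier (tree_space X 2)" "v \<in> carrier (tree_space X 2)"
  shows "skew u v \<in> carrier (tree_space X 3)"
  unfolding skew_def using tree_comp_closed[OF assms, of 1] tree_comp_closed[OF assms(2,1), of 2]
  by (intro tree_space_diff_closed) simp_all

lemma tree_subst_skew:
  assumes "\<And>a. a \<in> X \<Longrightarrow> \<sigma> a \<in> carrier (tree_space Y 2)"
    and u: "u \<in> carrier (tree_space X 2)" and v: "v \<in> carrier (tree_space X 2)"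
  shows "tree_subst \<sigma> (skew u v) = skew (tree_subst \<sigma> u) (tree_subst \<sigma> v)"
proof -
  have "tree_subst \<sigma> (u \<circ>\<^bsub>1\<^esub> v) = tree_subst \<sigma> u \<circ>\<^bsub>1\<^esub> tree_subst \<sigma> v"
    by (rule tree_subst_comp[OF assms]) auto
  moreover have "tree_subst \<sigma> (v \<circ>\<^bsub>2\<^esub> u) = tree_subst \<sigma> v \<circ>\<^bsub>2\<^esub> tree_subst \<sigma> u"
    by (rule tree_subst_comp[OF assms(1) v u]) auto
  ultimately show ?thesis by (simp add: skew_def tree_subst_diff)
qed

lemma skew_gen:
  "skew (gen x) (gen y) =
    Poly_Mapping.single (left_comb x y) 1 - Poly_Mapping.single (right_comb y x) 1"
  by (simp add: skew_def gen_comp_1 gen_comp_2)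

text \<open>Here \<open>gen a\<close> stands for the generator E*_a, and the sum is K*_b. In
  \<open>difference\<close> below, \<open>gen a\<close> stands for the symbol K*_a, and the value is
  E*_a with K*_(-1) read as 0. Both free operads carry the same labels
  \<open>{0..c}\<close>.\<close>

definition partial_sum :: "nat \<Rightarrow> (nat tree \<Rightarrow>\<^sub>0 'k::field)" where
  "partial_sum b = (\<Sum>a\<in>{0..b}. gen a)"

definition difference :: "nat \<Rightarrow> (nat tree \<Rightarrow>\<^sub>0 'k::field)" where
  "difference a = (case a of 0 \<Rightarrow> gen 0 | Suc a' \<Rightarrow> gen (Suc a') - gen a')"

lemma partial_sum_closed: "b \<in> {0..c} \<Longrightarrow> partial_sum b \<in> carrier (tree_space {0..c} 2)"
  unfolding partial_sum_def by (intro tree_space_sum gen_closed) auto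

lemma difference_closed: "a \<in> {0..c} \<Longrightarrow> difference a \<in> carrier (tree_space {0..c} 2)"
  unfolding difference_def
  by (cases a) (auto intro!: gen_closed tree_space_diff_closed)

text \<open>Consecutive partial sums differ by one generator.\<close>

lemma tree_subst_difference:
  assumes "a \<in> {0..c}"
  shows "tree_subst partial_sum (difference a) = (gen a :: nat tree \<Rightarrow>\<^sub>0 'k::field)"
proof -
  have g: "tree_subst partial_sum (gen a) = (partial_sum a :: nat tree \<Rightarrow>\<^sub>0 'k)" if "a \<le> c" for a
    using that partial_sum_closed by (intro tree_subst_gen[of "{0..c}" _ "{0..c}"]) auto
  then show ?thesis
    using assms by (cases a) (auto simp: difference_def tree_subst_diff partial_sum_def)
qed

text \<open>The sum of the differences telescopes. Together with
  \<open>tree_subst_difference\<close> this makes the two substitutions mutually inverse.\<close>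

lemma tree_subst_partial_sum:
  assumes "b \<in> {0..c}"
  shows "tree_subst difference (partial_sum b) = (gen b :: nat tree \<Rightarrow>\<^sub>0 'k::field)"
proof -
  have g: "tree_subst difference (gen a) = (difference a :: nat tree \<Rightarrow>\<^sub>0 'k)" if "a \<le> c" for a
    using that difference_closed by (intro tree_subst_gen[of "{0..c}" _ "{0..c}"]) auto
  have "b \<le> c \<Longrightarrow> ?thesis"
    by (induction b) (auto simp: partial_sum_def tree_subst_add g difference_def)
  then show ?thesis using assms by simp
qed

section \<open>The annihilator in terms of brackets\<close>

text \<open>By bilinearity the bracket is the sum of all \<open>skew (gen x) (gen y)\<close> over
  the rectangle \<open>x \<le> b\<close>, \<open>y \<le> a\<close>. The second term of a bracket has
  its arguments exchanged, hence \<open>right_comb y x\<close>.\<close>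

lemma lookup_skew_partial_sum:
  shows "Poly_Mapping.lookup (skew (partial_sum b) (partial_sum a)) (left_comb x y) =
    (if x \<le> b \<and> y \<le> a then 1 else (0 :: 'k::field))"
    and "Poly_Mapping.lookup (skew (partial_sum b) (partial_sum a)) (right_comb y x) =
    (if x \<le> b \<and> y \<le> a then - 1 else (0 :: 'k))"
proof -
  have D: "Poly_Mapping.lookup (skew (partial_sum b) (partial_sum a) :: nat tree \<Rightarrow>\<^sub>0 'k) t =
      (\<Sum>x'\<in>{0..b}. \<Sum>y'\<in>{0..a}. Poly_Mapping.lookup (gen x' \<circ>\<^bsub>1\<^esub> gen y') t) -
      (\<Sum>y'\<in>{0..a}. \<Sum>x'\<in>{0..b}. Poly_Mapping.lookup (gen y' \<circ>\<^bsub>2\<^esub> gen x') t)" for t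
    by (simp add: skew_def partial_sum_def tree_comp_sum_left tree_comp_sum_right lookup_minus
        lookup_sum sum.swap[of _ "{0..b}" "{0..a}"])
  have e: "(\<Sum>x'\<in>{0..m}. \<Sum>y'\<in>{0..n}. if x' = u \<and> y' = v then 1 else 0) =
      (if u \<le> m \<and> v \<le> n then 1 else (0 :: 'k))" for m n u v :: nat
    using sum_sum_single[of "{0..m}" "{0..n}" u v "\<lambda>_ _. 1"]
    by (auto intro!: sum.neutral)
  show "Poly_Mapping.lookup (skew (partial_sum b) (partial_sum a)) (left_comb x y) =
      (if x \<le> b \<and> y \<le> a then 1 else (0 :: 'k))"
    unfolding D gen_comp_1 gen_comp_2 lookup_single when_def
    using e[of x y a b] by (simp add: conj_commute)
  show "Poly_Mapping.lookup (skew (partial_sum b) (partial_sum a)) (right_comb y x) =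
      (if x \<le> b \<and> y \<le> a then - 1 else (0 :: 'k))"
    unfolding D gen_comp_1 gen_comp_2 lookup_single when_def
    using e[of y x b a] by (simp add: conj_commute)
qed

text \<open>For \<open>x \<le> y\<close>, the condition \<open>y \<le> a\<close> already forces
  \<open>x \<le> b\<close> because \<open>a \<le> b\<close>. So the coefficient does not depend on
  such \<open>x\<close>, as the first family of relations demands; the second family only needs
  opposite coefficients on the two combs.\<close>

lemma skew_partial_sum_annihilator:
  assumes "a \<le> b" "b \<le> c"
  shows "skew (partial_sum b) (partial_sum a) \<in> annihilator {0..c} (Hi_relations c)"
  unfolding annihilator_Hi_relations lookup_skew_partial_sum
  using assms by (auto intro!: skew_closed partial_sum_closed)

text \<open>The conditions on \<open>f\<close> leave only the left comb coefficients
  \<open>\<alpha> x y\<close> free and make them constant in \<open>x\<close> for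
  \<open>x \<le> y\<close>. The brackets with \<open>x \<le> y\<close> therefore add up to a bracket
  with \<open>partial_sum y\<close>.\<close>

lemma annihilator_decomposition:
  fixes f :: "nat tree \<Rightarrow>\<^sub>0 'k::field"
  assumes f: "f \<in> annihilator {0..c} (Hi_relations c)"
  defines "\<alpha> x y \<equiv> Poly_Mapping.lookup f (left_comb x y)"
  shows "f = (\<Sum>y\<in>{0..c}. Poly_Mapping.map ((*) (\<alpha> y y)) (skew (partial_sum y) (gen y)) +
    (\<Sum>x\<in>{y<..c}. Poly_Mapping.map ((*) (\<alpha> x y)) (skew (gen x) (gen y))))"
proof -
  let ?B = "\<lambda>x y. Poly_Mapping.map ((*) (\<alpha> x y)) (skew (gen x) (gen y))"
  have A: "f \<in> carrier (tree_space {0..c} 3)"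
    "\<And>a a' b. a \<le> b \<Longrightarrow> a' \<le> b \<Longrightarrow> b \<le> c \<Longrightarrow>
      \<alpha> a b + Poly_Mapping.lookup f (right_comb b a') = 0"
    "\<And>a b. a < b \<Longrightarrow> b \<le> c \<Longrightarrow> \<alpha> b a + Poly_Mapping.lookup f (right_comb a b) = 0"
    using f unfolding annihilator_Hi_relations \<alpha>_def by blast+
  \<comment> \<open>The first family of relations covers \<open>x \<le> y\<close>, the second one
    \<open>y < x\<close>.\<close>
  have right: "Poly_Mapping.lookup f (right_comb y x) = - \<alpha> x y" if "x \<le> c" "y \<le> c" for x y
    using A(2)[of x y x] A(3)[of y x] that by (cases "x \<le> y") (auto simp: eq_neg_iff_add_eq_0 add.commute)
  \<comment> \<open>Both coefficients are the negative of the one at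
    \<open>right_comb y y\<close>.\<close>
  have \<alpha>: "\<alpha> x y = \<alpha> y y" if "x \<le> y" "y \<le> c" for x y
    using A(2)[of x y y] A(2)[of y y y] that by (metis add_right_imp_eq order_refl)
  have zero: "Poly_Mapping.lookup f t = 0" if "\<not> (set_tree t \<subseteq> {0..c} \<and> size1 t = 3)" for t
    using A(1) that unfolding carrier_tree_space_lookup by blast
  \<comment> \<open>Combs with a label outside \<open>{0..c}\<close> get 0 here, which agrees with
    \<open>zero\<close>.\<close>
  have e: "(\<Sum>y'\<in>{0..c}. \<Sum>x'\<in>{0..c}. if y' = y \<and> x' = x then F x' y' else 0) =
      (if x \<le> c \<and> y \<le> c then F x y else (0 :: 'k))" for F x y
    using sum_sum_single[of "{0..c}" "{0..c}" y x "\<lambda>y x. F x y"] by (auto intro!: sum.neutral)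
  have "f = (\<Sum>y\<in>{0..c}. \<Sum>x\<in>{0..c}. ?B x y)"
  proof (rule poly_mapping_eqI)
    fix t
    have D: "Poly_Mapping.lookup (\<Sum>y\<in>{0..c}. \<Sum>x\<in>{0..c}. ?B x y) t =
      (\<Sum>y\<in>{0..c}. \<Sum>x\<in>{0..c}. \<alpha> x y * Poly_Mapping.lookup (skew (gen x) (gen y)) t)"
      by (simp add: lookup_sum)
    consider x y where "t = left_comb x y" | x y where "t = right_comb y x" | "size1 t \<noteq> 3"
      unfolding size1_eq_3 by blast
    then show "Poly_Mapping.lookup f t = Poly_Mapping.lookup (\<Sum>y\<in>{0..c}. \<Sum>x\<in>{0..c}. ?B x y) t"
    proof cases
      case 1
      have "(\<Sum>y'\<in>{0..c}. \<Sum>x'\<in>{0..c}. \<alpha> x' y' * Poly_Mapping.lookup (skew (gen x') (gen y')) t) =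
          (\<Sum>y'\<in>{0..c}. \<Sum>x'\<in>{0..c}. if y' = y \<and> x' = x then \<alpha> x' y' else 0)"
        by (intro sum.cong refl) (auto simp: skew_gen lookup_minus lookup_single when_def 1)
      then show ?thesis unfolding D e using zero[of t] 1 by (auto simp: \<alpha>_def)
    next
      case 2
      have "(\<Sum>y'\<in>{0..c}. \<Sum>x'\<in>{0..c}. \<alpha> x' y' * Poly_Mapping.lookup (skew (gen x') (gen y')) t) =
          (\<Sum>y'\<in>{0..c}. \<Sum>x'\<in>{0..c}. if y' = y \<and> x' = x then - \<alpha> x' y' else 0)"
        by (intro sum.cong refl) (auto simp: skew_gen lookup_minus lookup_single when_def 2)
      then show ?thesis unfolding D e using zero[of t] 2 right by auto
    next
      case 3
      then have "Poly_Mapping.lookup (skew (gen x) (gen y) :: nat tree \<Rightarrow>\<^sub>0 'k) t = 0" for x y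
        unfolding size1_eq_3 by (auto simp: skew_gen lookup_minus lookup_single when_def)
      then show ?thesis unfolding D using zero[of t] 3 by simp
    qed
  qed
  also have "\<dots> = (\<Sum>y\<in>{0..c}. Poly_Mapping.map ((*) (\<alpha> y y)) (skew (partial_sum y) (gen y)) +
      (\<Sum>x\<in>{y<..c}. ?B x y))"
  \<comment> \<open>For fixed \<open>y\<close>, the terms with \<open>x \<le> y\<close> share the
    coefficient \<open>\<alpha> y y\<close>, which is pulled out of their sum.\<close>
  proof (rule sum.cong[OF refl])
    fix y assume y: "y \<in> {0..c}"
    then have "{0..c} = {0..y} \<union> {y<..c}" by auto
    then have "(\<Sum>x\<in>{0..c}. ?B x y) = (\<Sum>x\<in>{0..y} \<union> {y<..c}. ?B x y)" by (simp only:)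
    also have "\<dots> = (\<Sum>x\<in>{0..y}. ?B x y) + (\<Sum>x\<in>{y<..c}. ?B x y)"
      by (rule sum.union_disjoint) auto
    also have "(\<Sum>x\<in>{0..y}. ?B x y) =
        (\<Sum>x\<in>{0..y}. Poly_Mapping.map ((*) (\<alpha> y y)) (skew (gen x) (gen y)))"
      using y by (intro sum.cong refl, subst \<alpha>) auto
    also have "\<dots> = Poly_Mapping.map ((*) (\<alpha> y y)) (skew (partial_sum y) (gen y))"
      by (simp add: partial_sum_def skew_sum_left scale_sum)
    finally show "(\<Sum>x\<in>{0..c}. ?B x y) =
      Poly_Mapping.map ((*) (\<alpha> y y)) (skew (partial_sum y) (gen y)) + (\<Sum>x\<in>{y<..c}. ?B x y)" .
  qed
  finally show ?thesis .
qed

text \<open>By \<open>annihilator_decomposition\<close> only two kinds of brackets have to be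
  expanded. Stating this for any subspace \<open>H\<close> containing the relations allows
  \<open>H\<close> to be the arity-3 part of the ideal that they generate.\<close>

lemma tree_subst_difference_annihilator:
  fixes f :: "nat tree \<Rightarrow>\<^sub>0 'k::field"
  assumes f: "f \<in> annihilator {0..c} (Hi_relations c)"
    and H: "submodule H base_field (tree_space {0..c} 3)"
    and rel: "Kstar_relations c \<subseteq> H"
  shows "tree_subst difference f \<in> H"
proof -
  note add = submodule_tree_space_add[OF H] and diff = submodule_tree_space_diff[OF H]
    and scale = submodule_tree_space_scale[OF H]
  have r: "skew (gen b) (gen a) \<in> H" if "a \<le> b" "b \<le> c" for a b
    using rel that unfolding Kstar_relations_def skew_def by blast
  have g: "tree_subst difference (gen a) = (difference a :: nat tree \<Rightarrow>\<^sub>0 'k)" if "a \<le> c" for a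
    using that difference_closed by (intro tree_subst_gen[of "{0..c}" _ "{0..c}"]) auto
  have s: "tree_subst difference (skew u v) = skew (tree_subst difference u) (tree_subst difference v)"
    if "u \<in> carrier (tree_space {0..c} 2)" "v \<in> carrier (tree_space {0..c} 2)" for u v :: "nat tree \<Rightarrow>\<^sub>0 'k"
    by (rule tree_subst_skew[OF difference_closed that])
  \<comment> \<open>The image is [K_y, K_y] - [K_y, K_(y-1)], or just [K_0, K_0] when
    \<open>y\<close> is 0.\<close>
  have 1: "tree_subst difference (skew (partial_sum y) (gen y)) \<in> H" if "y \<le> c" for y
  proof -
    have "tree_subst difference (skew (partial_sum y) (gen y)) =
        skew (gen y) (difference y :: nat tree \<Rightarrow>\<^sub>0 'k)"
      using that by (simp add: s partial_sum_closed gen_closed g tree_subst_partial_sum[where c = c])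
    then show ?thesis
      using that by (cases y) (auto simp: difference_def skew_diff_right intro!: diff r)
  qed
  \<comment> \<open>The image expands into brackets of K_x or K_(x-1) with K_y or K_(y-1). The
    critical one is [K_(x-1), K_y], a relation because \<open>y < x\<close> gives y at most x -
    1.\<close>
  have 2: "tree_subst difference (skew (gen x) (gen y)) \<in> H" if "y < x" "x \<le> c" for x y
  proof -
    have "tree_subst difference (skew (gen x) (gen y)) =
        skew (difference x) (difference y :: nat tree \<Rightarrow>\<^sub>0 'k)"
      using that by (simp add: s gen_closed g)
    then show ?thesis
      using that
      by (cases y; cases x)
        (auto simp: difference_def skew_diff_left skew_diff_right intro!: diff r)
  qed
  show ?thesis
    by (subst annihilator_decomposition[OF f])
      (auto simp: tree_subst_sum tree_subst_add tree_subst_scale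
        intro!: submodule_tree_space_sum[OF H] add scale 1 2)
qed

section \<open>The elements K*_b of the dual and the isomorphism\<close>

text \<open>\<open>Kstar\<close> is a sum of cosets formed in the quotient space. Adding one
  generator at a time moves the sum to representatives, so that the map on cosets can be evaluated
  on it.\<close>

lemma Kstar_eq_coset:
  fixes c :: nat
  assumes "b \<le> c"
  shows "(Kstar c b :: (nat tree \<Rightarrow>\<^sub>0 'k::field) set) =
    quadratic_ideal {0..c} (annihilator {0..c} (Hi_relations c)) 2
      +>\<^bsub>tree_space {0..c} 2\<^esub> partial_sum b"
proof -
  let ?P = "free_operad {0..c} :: ('k, _) operad"
  let ?I = "quadratic_ideal {0..c} (annihilator {0..c} (Hi_relations c)) :: nat \<Rightarrow> (nat tree \<Rightarrow>\<^sub>0 'k) set"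
  have P: "ns_operad ?P" by (rule ns_operad_free)
  have I: "operad_ideal ?P ?I"
    unfolding quadratic_ideal_def
    by (rule ns_operad.generated_ideal[OF P]) (auto simp: annihilator_def)
  have Q: "Hi_dual c = quotient_operad ?P ?I"
    by (simp add: Hi_dual_def koszul_dual_def quadratic_operad_def)
  interpret M: Module.module base_field "arity_space (Hi_dual c :: ('k, _) operad) 2"
    by (rule ns_operad.vector_space[OF ns_operad_Hi_dual])
  have E: "Estar c a = ?I 2 +>\<^bsub>tree_space {0..c} 2\<^esub> gen a" for a
    by (simp add: Estar_def quadratic_gen_def)
  have Ec: "Estar c a \<in> elems (Hi_dual c :: ('k, _) operad) 2" if "a \<le> c" for a
    unfolding Q ns_operad.elems_quotient[OF P I] E using that by (auto intro!: gen_closed)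
  show ?thesis
    using assms
  proof (induction b)
    case 0
    then show ?case using Ec[of 0] by (simp add: Kstar_def partial_sum_def E)
  next
    case (Suc b)
    have "Kstar c (Suc b) = (\<Oplus>\<^bsub>arity_space (Hi_dual c :: ('k, _) operad) 2\<^esub>a\<in>insert (Suc b) {0..b}. Estar c a)"
      unfolding Kstar_def by (simp add: atLeast0_atMost_Suc)
    also have "\<dots> = Estar c (Suc b) \<oplus>\<^bsub>arity_space (Hi_dual c :: ('k, _) operad) 2\<^esub> Kstar c b"
      unfolding Kstar_def using Suc.prems by (intro M.finsum_insert) (auto intro!: Ec)
    also have "\<dots> = ?I 2 +>\<^bsub>tree_space {0..c} 2\<^esub> (gen (Suc b) + partial_sum b)"
      using ns_operad.cls_add[OF P I, of "gen (Suc b)" 2 "partial_sum b"] Suc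
      by (simp add: Q E gen_closed partial_sum_closed)
    finally show ?case by (simp add: partial_sum_def add.commute)
  qed
qed

theorem proposition4p2p6:
  fixes c :: nat
  shows "\<exists>\<phi> \<in> operad_iso (Hi_dual c :: ('k::field_char_0, _) operad) (Kstar_operad c).
    \<forall>b\<in>{0..c}. \<phi> 2 (Kstar c b) = Kstar_symbol c b"
proof -
  let ?P = "free_operad {0..c} :: ('k, _) operad"
  let ?A = "annihilator {0..c} (Hi_relations c) :: (nat tree \<Rightarrow>\<^sub>0 'k) set"
  let ?I = "quadratic_ideal {0..c} ?A" and ?J = "quadratic_ideal {0..c} (Kstar_relations c :: (nat tree \<Rightarrow>\<^sub>0 'k) set)"
  \<comment> \<open>\<open>?f\<close> rewrites the E* in terms of the K*, and \<open>?g\<close>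
    rewrites the K* in terms of the E*.\<close>
  let ?f = "tree_subst difference :: (nat tree \<Rightarrow>\<^sub>0 'k) \<Rightarrow> _"
  let ?g = "tree_subst partial_sum :: (nat tree \<Rightarrow>\<^sub>0 'k) \<Rightarrow> _"
  have P: "ns_operad ?P" by (rule ns_operad_free)
  have A: "?A \<subseteq> elems ?P 3" by (auto simp: annihilator_def)
  have K: "Kstar_relations c = {skew (gen b) (gen a) :: nat tree \<Rightarrow>\<^sub>0 'k | a b. b \<le> c \<and> a \<le> b}"
    by (simp add: Kstar_relations_def skew_def)
  have Kc: "(Kstar_relations c :: (nat tree \<Rightarrow>\<^sub>0 'k) set) \<subseteq> elems ?P 3"
    unfolding K by (auto intro!: skew_closed gen_closed)
  have I: "operad_ideal ?P ?I" and J: "operad_ideal ?P ?J"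
    unfolding quadratic_ideal_def
    by (rule ns_operad.generated_ideal[OF P]; use A Kc in auto)+
  have AI: "?A \<subseteq> ?I 3" and KJ: "Kstar_relations c \<subseteq> ?J 3"
    unfolding quadratic_ideal_def generated_ideal_def by (auto simp: le_fun_def Inf_apply)
  have f: "(\<lambda>n. ?f) \<in> operad_hom ?P ?P" and g: "(\<lambda>n. ?g) \<in> operad_hom ?P ?P"
    by (rule tree_subst_hom, erule difference_closed partial_sum_closed)+
  have fg: "?f (?g x) = x" and gf: "?g (?f x) = x" if "x \<in> elems ?P n" for x n
    using tree_subst_inverse[OF partial_sum_closed difference_closed tree_subst_partial_sum]
      tree_subst_inverse[OF difference_closed partial_sum_closed tree_subst_difference] that
    by auto
  \<comment> \<open>Only arity 3 contains generating relations, and there the subspace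
    \<open>H\<close> of \<open>tree_subst_difference_annihilator\<close> is
    \<open>?J 3\<close>.\<close>
  have IJ: "?f x \<in> ?J n" if x: "x \<in> ?I n" for x n
    by (rule operad_hom_generated_ideal[OF P f P J _ x[unfolded quadratic_ideal_def]])
      (use A KJ J in \<open>auto simp: operad_ideal_def tree_subst_difference_annihilator split: if_splits\<close>)
  have sg: "?g (skew (gen b) (gen a)) = skew (partial_sum b) (partial_sum a)" if "a \<le> b" "b \<le> c" for a b
  proof -
    have gen: "?g (gen a) = partial_sum a" if "a \<le> c" for a
      using that partial_sum_closed by (intro tree_subst_gen[of "{0..c}" _ "{0..c}"]) auto
    have "?g (skew (gen b) (gen a)) = skew (?g (gen b)) (?g (gen a))"
      using that by (intro tree_subst_skew[of "{0..c}" _ "{0..c}"] partial_sum_closed gen_closed) auto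
    then show ?thesis using that by (simp add: gen)
  qed
  have gK: "?g x \<in> ?I 3" if x: "x \<in> Kstar_relations c" for x
  proof -
    obtain a b where "x = skew (gen b) (gen a)" "a \<le> b" "b \<le> c" using x unfolding K by blast
    then show ?thesis using AI skew_partial_sum_annihilator[of a b c] by (auto simp only: sg)
  qed
  \<comment> \<open>Conversely, a relation between K* becomes a bracket of partial sums, which lies
    in the annihilator.\<close>
  have JI: "?g x \<in> ?I n" if x: "x \<in> ?J n" for x n
    by (rule operad_hom_generated_ideal[OF P g P I _ x[unfolded quadratic_ideal_def]])
      (use Kc gK in \<open>auto split: if_splits\<close>)
  have iso: "(\<lambda>n. (`) ?f) \<in> operad_iso (Hi_dual c) (Kstar_operad c)"
    unfolding Hi_dual_def koszul_dual_def quadratic_operad_def Kstar_operad_def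
    by (rule operad_iso_quotient[OF P P I J f g gf fg IJ JI])
  moreover have "?f ` Kstar c b = Kstar_symbol c b" if b: "b \<in> {0..c}" for b
  proof -
    \<comment> \<open>The class of \<open>partial_sum b\<close> is \<open>Kstar c b\<close>, and
      \<open>?f\<close> takes this representative to \<open>gen b\<close>, a representative of the
      formal symbol.\<close>
    have "?f ` (?I 2 +>\<^bsub>arity_space ?P 2\<^esub> partial_sum b) =
        ?J 2 +>\<^bsub>arity_space ?P 2\<^esub> ?f (partial_sum b)"
      by (rule operad_hom_image_coset[OF P P I J f g fg IJ JI]) (use b partial_sum_closed in auto)
    then show ?thesis
      using b by (simp add: Kstar_eq_coset Kstar_symbol_def quadratic_gen_def tree_subst_partial_sum)
  qed
  ultimately show ?thesis by (intro bexI[OF _ iso]) auto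
qed

end
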